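(* Let $V$ be a weak quantum vertex algebra with a constant map $\mathcal{S}$ and let $(W,Y_W)$ be a $V$-module. Then $$Y_W^*(v,x)\alpha\in D(W)((x))\quad\text{for all } v\in V,\ \alpha\in D(W).$$ Furthermore, the pair $(D(W),Y_W^* )$ carries the structure of a $\phi$-coordinated $V^o$-module with $\phi(x,z)=\frac{x}{1+zx}$.
   Context: All vector spaces are over $\mathbb{C}$. For a vector space $U$: $U((x))$ is the space of formal Laurent series with finitely many negative powers; $U((x_1,x_2))=U[[x_1,x_2]][x_1^{-1},x_2^{-1}]$. Let $\delta(x)=\sum_{n\in\mathbb{Z}}x^n$; powers $(x_1\pm x_2)^n$ are expanded in nonnegative powers of the second variable $x_2$, and similarly for series in $x_1\pm x_2$. **Weak quantum vertex algebra.** A vector space $V$ with a linear map $Y(\cdot,x):V\to(\mathrm{End}\,V)[[x,x^{-1}]]$, $v\mapsto Y(v,x)=\sum_{n\in\mathbb{Z}}v_nx^{-n-1}$, and a vector $\mathbf 1\in V$ such that $Y(u,x)v\in V((x))$ for $u,v\in V$; $Y(\mathbf 1,x)v=v$, $Y(u,x)\mathbf 1\in V[[x]]$, $\lim_{x\to0}Y(u,x)\mathbf 1=u$; and for any $u,v\in V$ there exist finitely many $u^{(i)},v^{(i)}\in V$, $f_i(x)\in\mathbb{C}((x))$ ($1\le i\le r$) such that $$x_0^{-1}\delta\left(\tfrac{x_1-x_2}{x_0}\right)Y(u,x_1)Y(v,x_2)-x_0^{-1}\delta\left(\tfrac{x_2-x_1}{-x_0}\right)\sum_{i=1}^r f_i(x_2-x_1)Y(v^{(i)},x_2)Y(u^{(i)},x_1)=x_2^{-1}\delta\left(\tfrac{x_1-x_0}{x_2}\right)Y(Y(u,x_0)v,x_2).\quad(\ast)$$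 Equivalently to the last condition, there is a linear map $\mathcal{S}(x):V\otimes V\to V\otimes V\otimes\mathbb{C}((x))$ such that $(\ast)$ holds with $\mathcal{S}(x)(v\otimes u)=\sum_i v^{(i)}\otimes u^{(i)}\otimes f_i(x)$. "With a constant map $\mathcal{S}$" means that such a map can be chosen independent of $x$, i.e. a linear map $\mathcal{S}:V\otimes V\to V\otimes V$, so that for all $u,v$, $(\ast)$ holds with all $f_i=1$ and $\mathcal{S}(v\otimes u)=\sum_iv^{(i)}\otimes u^{(i)}$. The operator $\mathcal{D}$ on $V$ is $\mathcal{D}(v)=\lim_{x\to0}\frac{d}{dx}Y(v,x)\mathbf 1$. **Opposite algebra.** $V^o=(V,Y^o,\mathbf 1)$, where $Y^o(u,x)v=e^{x\mathcal{D}}Y(v,-x)u$ for $u,v\in V$; it is again a weak quantum vertex algebra. **$\phi$-coordinated module.** An associate of $F_{\mathrm{add}}(x,y)=x+y$ is a series $\phi(x,z)\in\mathbb{C}((x))[[z]]$ with $\phi(x,0)=x$, $\phi(\phi(x,y),z)=\phi(x,y+z)$. The series $\frac{x}{1+zx}$ (expanded in nonnegative powers of $z$) and $x+z$ are associates. For an associate $\phi$, a $\phi$-coordinated $V$-module is a vector space $W$ with a linear map $Y_W(\cdot,x):V\to(\mathrm{End}\,W)[[x,x^{-1}]]$ such that $Y_W(v,x)w\in W((x))$ for $v\in V,w\in W$; $Y_W(\mathbf 1,x)=1_W$; and for any $u,v\in V$ there is $k\in\mathbb{N}$ (nonnegative integer) with $(x_1-x_2)^kY_W(u,x_1)Y_W(v,x_2)\in\mathrm{Hom}(W,W((x_1,x_2)))$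 and $$\left((x_1-x_2)^kY_W(u,x_1)Y_W(v,x_2)\right)|_{x_1=\phi(x_2,z)}=(\phi(x_2,z)-x_2)^kY_W(Y(u,z)v,x_2),$$ the substituted series being an element of $(\mathrm{Hom}(W,W((x_2))))[[z]]$. A $V$-module is a $\phi$-coordinated $V$-module with $\phi(x,z)=x+z$. **The dual.** For a $V$-module $(W,Y_W)$, let $W^*$ be the full dual space and define $Y_W^*(\cdot,x):V\to(\mathrm{End}\,W^* )[[x,x^{-1}]]$ by $\langle Y_W^*(v,x)\alpha,w\rangle=\langle\alpha,Y_W(v,x^{-1})w\rangle$ for $v\in V,\alpha\in W^*,w\in W$. $D(W)$ is the subspace of all $\alpha\in W^*$ such that $Y_W^*(v,x)\alpha\in W^*((x))$ for every $v\in V$. *)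

theory Defs
  imports
    Complex_Main
    "HOL-Library.Function_Algebras"
    "HOL-Library.Product_Plus"
    "HOL-Library.Poly_Mapping"
    "HOL-Computational_Algebra.Formal_Laurent_Series"
begin

section \<open>Complex vector spaces\<close>

class complex_vector = ab_group_add +
  fixes scaleC :: "complex \<Rightarrow> 'a \<Rightarrow> 'a"  (infixr \<open>*\<^sub>C\<close> 75)
  assumes scaleC_add_right: "a *\<^sub>C (x + y) = a *\<^sub>C x + a *\<^sub>C y"
    and scaleC_add_left: "(a + b) *\<^sub>C x = a *\<^sub>C x + b *\<^sub>C x"
    and scaleC_scaleC: "a *\<^sub>C b *\<^sub>C x = (a * b) *\<^sub>C x"
    and scaleC_one: "1 *\<^sub>C x = x"

global_interpretation cvec: vector_space "scaleC :: complex \<Rightarrow> 'a \<Rightarrow> 'a::complex_vector"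
  by standard (simp_all add: scaleC_add_right scaleC_add_left scaleC_scaleC scaleC_one)

abbreviation clinear :: "('a::complex_vector \<Rightarrow> 'b::complex_vector) \<Rightarrow> bool"
  where "clinear \<equiv> Vector_Spaces.linear scaleC scaleC"

instantiation complex :: complex_vector
begin
definition scaleC_complex :: "complex \<Rightarrow> complex \<Rightarrow> complex"
  where "scaleC_complex a x = a * x"
instance
  by standard (simp_all add: scaleC_complex_def algebra_simps)
end

instantiation "fun" :: (type, complex_vector) complex_vector
begin
definition scaleC_fun :: "complex \<Rightarrow> ('a \<Rightarrow> 'b) \<Rightarrow> 'a \<Rightarrow> 'b"
  where "scaleC_fun a f = (\<lambda>x. a *\<^sub>C f x)"
instance
  by standard
    (simp_all add: scaleC_fun_def fun_eq_iff scaleC_add_right scaleC_add_left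
      scaleC_scaleC scaleC_one)
end

instantiation poly_mapping :: (type, complex_vector) complex_vector
begin
lift_definition scaleC_poly_mapping :: "complex \<Rightarrow> ('a \<Rightarrow>\<^sub>0 'b) \<Rightarrow> 'a \<Rightarrow>\<^sub>0 'b"
  is "\<lambda>a f k. a *\<^sub>C f k"
proof -
  fix a and f :: "'a \<Rightarrow> 'b"
  assume "finite {k. f k \<noteq> 0}"
  then show "finite {k. a *\<^sub>C f k \<noteq> 0}"
    by (rule rev_finite_subset) auto
qed
instance
  by standard
    (transfer, simp add: fun_eq_iff scaleC_add_right scaleC_add_left scaleC_scaleC scaleC_one)+
end


section \<open>The tensor product of two vector spaces\<close>

text \<open>The free vector space on pairs, modulo the subspace spanned by the bilinearity relations.\<close>

abbreviation free_pair :: "'a \<Rightarrow> 'b \<Rightarrow> ('a \<times> 'b) \<Rightarrow>\<^sub>0 complex"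
  where "free_pair v w \<equiv> Poly_Mapping.single (v, w) 1"

definition tensor_relators :: "(('a::complex_vector \<times> 'b::complex_vector) \<Rightarrow>\<^sub>0 complex) set"
  where "tensor_relators =
    {free_pair (v + v') w - free_pair v w - free_pair v' w | v v' w. True} \<union>
    {free_pair v (w + w') - free_pair v w - free_pair v w' | v w w'. True} \<union>
    {free_pair (a *\<^sub>C v) w - a *\<^sub>C free_pair v w | a v w. True} \<union>
    {free_pair v (a *\<^sub>C w) - a *\<^sub>C free_pair v w | a v w. True}"

definition tensor_rel ::
  "(('a::complex_vector \<times> 'b::complex_vector) \<Rightarrow>\<^sub>0 complex) \<Rightarrow> (('a \<times> 'b) \<Rightarrow>\<^sub>0 complex) \<Rightarrow> bool"
  where "tensor_rel p q \<longleftrightarrow> p - q \<in> cvec.span tensor_relators"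

lemma equivp_tensor_rel:
  "equivp (tensor_rel :: (('a::complex_vector \<times> 'b::complex_vector) \<Rightarrow>\<^sub>0 complex) \<Rightarrow> _)"
  (is "equivp ?R")
proof (rule equivpI)
  show "reflp ?R"
    by (rule reflpI) (simp add: tensor_rel_def cvec.span_zero)
  show "symp ?R"
    by (rule sympI) (metis tensor_rel_def cvec.span_neg minus_diff_eq)
  show "transp ?R"
  proof (rule transpI)
    fix p q r :: "('a \<times> 'b) \<Rightarrow>\<^sub>0 complex"
    assume "tensor_rel p q" "tensor_rel q r"
    then have "(p - q) + (q - r) \<in> cvec.span tensor_relators"
      unfolding tensor_rel_def by (rule cvec.span_add)
    then show "tensor_rel p r" by (simp add: tensor_rel_def)
  qed
qed

quotient_type (overloaded) ('a, 'b) tensor =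
  "('a::complex_vector \<times> 'b::complex_vector) \<Rightarrow>\<^sub>0 complex" / tensor_rel
  by (rule equivp_tensor_rel)

instantiation tensor :: (complex_vector, complex_vector) complex_vector
begin

lift_definition zero_tensor :: "('a, 'b) tensor" is 0 .

lift_definition plus_tensor :: "('a, 'b) tensor \<Rightarrow> ('a, 'b) tensor \<Rightarrow> ('a, 'b) tensor" is "(+)"
  unfolding tensor_rel_def by (metis add_diff_add cvec.span_add)

lift_definition uminus_tensor :: "('a, 'b) tensor \<Rightarrow> ('a, 'b) tensor" is uminus
  unfolding tensor_rel_def by (metis cvec.span_neg minus_diff_minus)

lift_definition minus_tensor :: "('a, 'b) tensor \<Rightarrow> ('a, 'b) tensor \<Rightarrow> ('a, 'b) tensor" is "(-)"
proof -
  fix p p' q q' :: "('a \<times> 'b) \<Rightarrow>\<^sub>0 complex"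
  assume "tensor_rel p p'" "tensor_rel q q'"
  then have "(p - p') - (q - q') \<in> cvec.span tensor_relators"
    unfolding tensor_rel_def by (rule cvec.span_diff)
  then show "tensor_rel (p - q) (p' - q')"
    by (simp add: tensor_rel_def algebra_simps)
qed

lift_definition scaleC_tensor :: "complex \<Rightarrow> ('a, 'b) tensor \<Rightarrow> ('a, 'b) tensor" is scaleC
  unfolding tensor_rel_def by (metis cvec.scale_right_diff_distrib cvec.span_scale)

instance
  by standard
    (transfer, simp add: tensor_rel_def cvec.span_zero algebra_simps scaleC_add_right
      scaleC_add_left scaleC_scaleC scaleC_one)+

end

lift_definition tensor_pair :: "'a::complex_vector \<Rightarrow> 'b::complex_vector \<Rightarrow> ('a, 'b) tensor"
    (infixl \<open>\<otimes>\<^sub>C\<close> 72)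
  is free_pair .

lemma tensor_pair_bilinear:
  "(v + v') \<otimes>\<^sub>C w = v \<otimes>\<^sub>C w + v' \<otimes>\<^sub>C w"
  "v \<otimes>\<^sub>C (w + w') = v \<otimes>\<^sub>C w + v \<otimes>\<^sub>C w'"
  "(a *\<^sub>C v) \<otimes>\<^sub>C w = a *\<^sub>C (v \<otimes>\<^sub>C w)"
  "v \<otimes>\<^sub>C (a *\<^sub>C w) = a *\<^sub>C (v \<otimes>\<^sub>C w)"
  by (transfer, unfold tensor_rel_def diff_diff_eq[symmetric],
      rule cvec.span_base, unfold tensor_relators_def, blast)+


section \<open>Formal series\<close>

text \<open>
  A formal series with coefficients in \<open>U\<close> is the function sending an exponent (an integer, or
  a tuple of integers for several variables) to its coefficient. A series of operators on \<open>U\<close> is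
  handled through its values on vectors. \<open>Sum_any\<close> is the sum of a finitely supported family;
  every sum below has finite support under the truncation conditions in force where it is used.
\<close>

definition laurent_on :: "'u::zero set \<Rightarrow> (int \<Rightarrow> 'u) \<Rightarrow> bool"
  where "laurent_on U f \<longleftrightarrow> (\<forall>n. f n \<in> U) \<and> (\<exists>N. \<forall>n<N. f n = 0)"

definition laurent2_on :: "'u::zero set \<Rightarrow> (int \<times> int \<Rightarrow> 'u) \<Rightarrow> bool"
  where "laurent2_on U f \<longleftrightarrow>
    (\<forall>m n. f (m, n) \<in> U) \<and> (\<exists>N. \<forall>m n. m < N \<or> n < N \<longrightarrow> f (m, n) = 0)"

definition series_mult ::
  "('i::ab_group_add \<Rightarrow> complex) \<Rightarrow> ('i \<Rightarrow> 'u::complex_vector) \<Rightarrow> 'i \<Rightarrow> 'u"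
  where "series_mult f g n = (\<Sum>m. f m *\<^sub>C g (n - m))"

text \<open>
  The coefficient of \<open>y^i z^j\<close> in \<open>(y - z)^n\<close>, expanded in nonnegative powers of \<open>z\<close>.
\<close>

definition diff_power :: "int \<Rightarrow> int \<Rightarrow> int \<Rightarrow> complex"
  where "diff_power n i j =
    (if j \<ge> 0 \<and> i + j = n then (-1) ^ nat j * (of_int n gchoose nat j) else 0)"

text \<open>
  The three delta functions of the Jacobi identity; the argument \<open>(a, b, c)\<close> is the exponent of
  \<open>x\<^sub>0^a x\<^sub>1^b x\<^sub>2^c\<close>. They are, respectively,
  \<open>x\<^sub>0\<^sup>-\<^sup>1 \<delta>((x\<^sub>1 - x\<^sub>2)/x\<^sub>0) = \<Sum>n. x\<^sub>0^(-n-1) (x\<^sub>1 - x\<^sub>2)^n\<close>,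
  \<open>x\<^sub>0\<^sup>-\<^sup>1 \<delta>((x\<^sub>2 - x\<^sub>1)/(-x\<^sub>0)) = \<Sum>n. (-1)^n x\<^sub>0^(-n-1) (x\<^sub>2 - x\<^sub>1)^n\<close> and
  \<open>x\<^sub>2\<^sup>-\<^sup>1 \<delta>((x\<^sub>1 - x\<^sub>0)/x\<^sub>2) = \<Sum>n. x\<^sub>2^(-n-1) (x\<^sub>1 - x\<^sub>0)^n\<close>.
\<close>

definition delta_12_0 :: "int \<times> int \<times> int \<Rightarrow> complex"
  where "delta_12_0 = (\<lambda>(a, b, c). diff_power (- a - 1) b c)"

definition delta_21_0 :: "int \<times> int \<times> int \<Rightarrow> complex"
  where "delta_21_0 = (\<lambda>(a, b, c). (-1) powi (- a - 1) * diff_power (- a - 1) c b)"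

definition delta_10_2 :: "int \<times> int \<times> int \<Rightarrow> complex"
  where "delta_10_2 = (\<lambda>(a, b, c). diff_power (- c - 1) b a)"

text \<open>The coefficient of \<open>x\<^sub>1^b x\<^sub>2^c\<close> in \<open>f(x\<^sub>2 - x\<^sub>1)\<close>.\<close>

definition at_diff_21 :: "complex fls \<Rightarrow> int \<times> int \<Rightarrow> complex"
  where "at_diff_21 f = (\<lambda>(b, c). fls_nth f (b + c) * diff_power (b + c) c b)"


section \<open>Weak quantum vertex algebras\<close>

text \<open>
  Throughout, \<open>Y u n v\<close> is the coefficient of \<open>x^n\<close> in \<open>Y(u,x)v\<close>, that is, \<open>u\<^sub>m v\<close> for
  \<open>m = - n - 1\<close>. The list \<open>ts\<close> holds the triples \<open>(v\<^sup>(\<^sup>i\<^sup>), u\<^sup>(\<^sup>i\<^sup>), f\<^sub>i)\<close>.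
\<close>

definition S_jacobi ::
  "('v::complex_vector \<Rightarrow> int \<Rightarrow> 'v \<Rightarrow> 'v) \<Rightarrow> 'v \<Rightarrow> 'v \<Rightarrow> ('v \<times> 'v \<times> complex fls) list \<Rightarrow> bool"
  where "S_jacobi Y u v ts \<longleftrightarrow> (\<forall>w.
    series_mult delta_12_0 (\<lambda>(a, b, c). if a = 0 then Y u b (Y v c w) else 0)
    - series_mult delta_21_0 (\<lambda>(a, b, c). if a = 0
        then \<Sum>(v', u', f)\<leftarrow>ts. series_mult (at_diff_21 f) (\<lambda>(b, c). Y v' c (Y u' b w)) (b, c)
        else 0)
    = series_mult delta_10_2 (\<lambda>(a, b, c). if b = 0 then Y (Y u a v) c w else 0))"

locale weak_quantum_vertex_algebra =
  fixes Y :: "'v::complex_vector \<Rightarrow> int \<Rightarrow> 'v \<Rightarrow> 'v" and vac :: 'v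
  assumes Y_linear_left: "clinear (\<lambda>u. Y u n v)"
    and Y_linear_right: "clinear (Y u n)"
    and Y_laurent: "laurent_on UNIV (\<lambda>n. Y u n v)"
    and Y_vacuum: "Y vac n v = (if n = 0 then v else 0)"
    and Y_creation: "n < 0 \<Longrightarrow> Y u n vac = 0" "Y u 0 vac = u"
    and S_locality: "\<exists>ts. S_jacobi Y u v ts"

locale constant_weak_quantum_vertex_algebra = weak_quantum_vertex_algebra Y vac
  for Y :: "'v::complex_vector \<Rightarrow> int \<Rightarrow> 'v \<Rightarrow> 'v" and vac :: 'v +
  assumes constant_S: "\<exists>S :: ('v, 'v) tensor \<Rightarrow> ('v, 'v) tensor. clinear S \<and>
    (\<forall>u v. \<exists>ts. S (v \<otimes>\<^sub>C u) = (\<Sum>(v', u')\<leftarrow>ts. v' \<otimes>\<^sub>C u') \<and>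
      S_jacobi Y u v (map (\<lambda>(v', u'). (v', u', 1)) ts))"

definition formal_deriv :: "(int \<Rightarrow> 'u::complex_vector) \<Rightarrow> int \<Rightarrow> 'u"
  where "formal_deriv f n = of_int (n + 1) *\<^sub>C f (n + 1)"

definition D_operator :: "('v::complex_vector \<Rightarrow> int \<Rightarrow> 'v \<Rightarrow> 'v) \<Rightarrow> 'v \<Rightarrow> 'v \<Rightarrow> 'v"
  where "D_operator Y vac v = formal_deriv (\<lambda>n. Y v n vac) 0"

text \<open>\<open>Y\<^sup>o(u,x)v = e\<^sup>x\<^sup>D Y(v,-x)u\<close>\<close>

definition opposite ::
  "('v::complex_vector \<Rightarrow> int \<Rightarrow> 'v \<Rightarrow> 'v) \<Rightarrow> 'v \<Rightarrow> 'v \<Rightarrow> int \<Rightarrow> 'v \<Rightarrow> 'v"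
  where "opposite Y vac u n v =
    (\<Sum>j::nat. (1 / fact j) *\<^sub>C
      (D_operator Y vac ^^ j) ((-1) powi (n - int j) *\<^sub>C Y v (n - int j) u))"


section \<open>\<open>\<phi>\<close>-coordinated modules\<close>

text \<open>
  An element \<open>\<psi>(x,z)\<close> of \<open>\<complex>((x))[[z]]\<close> has type \<^typ>\<open>complex fls fps\<close>, the outer variable
  being \<open>z\<close>; \<open>zx_coeff \<psi> (p, q)\<close> is its coefficient of \<open>z^p x^q\<close>.
\<close>

definition zx_coeff :: "complex fls fps \<Rightarrow> int \<times> int \<Rightarrow> complex"
  where "zx_coeff \<psi> = (\<lambda>(p, q). if p < 0 then 0 else fls_nth (fps_nth \<psi> (nat p)) q)"

text \<open>
  The coefficient of \<open>z^p x\<^sub>2^q\<close> in \<open>F(x\<^sub>1,x\<^sub>2)|\<^bsub>x\<^sub>1=\<phi>(x\<^sub>2,z)\<^esub>\<close>, for \<open>F\<close> in \<open>U((x\<^sub>1,x\<^sub>2))\<close>. As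
  \<open>\<phi>(x,0) = x\<close> is a unit in \<open>\<complex>((x))\<close>, negative powers of \<open>\<phi>\<close> exist in \<open>\<complex>((x))[[z]]\<close>.
\<close>

definition subst_phi ::
  "complex fls fps \<Rightarrow> (int \<times> int \<Rightarrow> 'u::complex_vector) \<Rightarrow> int \<times> int \<Rightarrow> 'u"
  where "subst_phi \<phi> F = (\<lambda>(p, q). \<Sum>(m, n). zx_coeff (\<phi> powi m) (p, q - n) *\<^sub>C F (m, n))"

text \<open>
  The coefficient of \<open>x\<^sub>1^m x\<^sub>2^n\<close> in \<open>(x\<^sub>1 - x\<^sub>2)^k Y\<^sub>W(u,x\<^sub>1) Y\<^sub>W(v,x\<^sub>2) w\<close>.
\<close>

definition regularized_product ::
  "('v \<Rightarrow> int \<Rightarrow> 'w \<Rightarrow> 'w::complex_vector) \<Rightarrow> nat \<Rightarrow> 'v \<Rightarrow> 'v \<Rightarrow> 'w \<Rightarrow> int \<times> int \<Rightarrow> 'w"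
  where "regularized_product YW k u v w =
    series_mult (\<lambda>(m, n). diff_power (int k) m n) (\<lambda>(m, n). YW u m (YW v n w))"

text \<open>
  The module is a subspace \<open>W\<close> of an ambient vector space, so that the notion applies to spaces
  of functionals; only the restriction of the operators \<open>YW v n\<close> to \<open>W\<close> matters.
\<close>

locale phi_coordinated_module =
  fixes \<phi> :: "complex fls fps"
    and Y :: "'v::complex_vector \<Rightarrow> int \<Rightarrow> 'v \<Rightarrow> 'v" and vac :: 'v
    and W :: "'w::complex_vector set" and YW :: "'v \<Rightarrow> int \<Rightarrow> 'w \<Rightarrow> 'w"
  assumes W_subspace: "cvec.subspace W"
    and YW_closed: "w \<in> W \<Longrightarrow> YW v n w \<in> W"
    and YW_linear_left: "w \<in> W \<Longrightarrow> clinear (\<lambda>v. YW v n w)"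
    and YW_add_right: "w \<in> W \<Longrightarrow> w' \<in> W \<Longrightarrow> YW v n (w + w') = YW v n w + YW v n w'"
    and YW_scale_right: "w \<in> W \<Longrightarrow> YW v n (a *\<^sub>C w) = a *\<^sub>C YW v n w"
    and YW_laurent: "w \<in> W \<Longrightarrow> laurent_on W (\<lambda>n. YW v n w)"
    and YW_vacuum: "w \<in> W \<Longrightarrow> YW vac n w = (if n = 0 then w else 0)"
    and YW_weak_assoc:
      "\<exists>k. \<forall>w\<in>W. laurent2_on W (regularized_product YW k u v w) \<and>
        subst_phi \<phi> (regularized_product YW k u v w) =
        series_mult (zx_coeff ((\<phi> - fps_const fls_X) ^ k)) (\<lambda>(p, q). YW (Y u p v) q w)"

text \<open>The associates \<open>x + z\<close> and \<open>x / (1 + zx)\<close>.\<close>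

definition phi_add :: "complex fls fps"
  where "phi_add = fps_const fls_X + fps_X"

definition phi_inv :: "complex fls fps"
  where "phi_inv = fps_const fls_X / (1 + fps_X * fps_const fls_X)"

abbreviation va_module ::
  "('v::complex_vector \<Rightarrow> int \<Rightarrow> 'v \<Rightarrow> 'v) \<Rightarrow> 'v \<Rightarrow> 'w::complex_vector set \<Rightarrow>
    ('v \<Rightarrow> int \<Rightarrow> 'w \<Rightarrow> 'w) \<Rightarrow> bool"
  where "va_module \<equiv> phi_coordinated_module phi_add"


section \<open>The dual\<close>

definition full_dual :: "('w::complex_vector \<Rightarrow> complex) set"
  where "full_dual = {\<alpha>. clinear \<alpha>}"

text \<open>\<open>\<langle>Y\<^sub>W\<^sup>*(v,x)\<alpha>, w\<rangle> = \<langle>\<alpha>, Y\<^sub>W(v,x\<^sup>-\<^sup>1)w\<rangle>\<close>\<close>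

definition dual_Y ::
  "('v \<Rightarrow> int \<Rightarrow> 'w \<Rightarrow> 'w) \<Rightarrow> 'v \<Rightarrow> int \<Rightarrow> ('w \<Rightarrow> complex) \<Rightarrow> 'w \<Rightarrow> complex"
  where "dual_Y YW v n \<alpha> = (\<lambda>w. \<alpha> (YW v (- n) w))"

definition dual_D ::
  "('v \<Rightarrow> int \<Rightarrow> 'w \<Rightarrow> 'w::complex_vector) \<Rightarrow> ('w \<Rightarrow> complex) set"
  where "dual_D YW =
    {\<alpha> \<in> full_dual. \<forall>v. laurent_on full_dual (\<lambda>n. dual_Y YW v n \<alpha>)}"

end

theory Submission
  imports Defs
begin

text \<open>
  For \<open>\<alpha>\<close> in \<open>D(W)\<close> the powers of \<open>x\<^sub>1\<close> in \<open>\<alpha> Y\<^sub>W(v,x\<^sub>1) Y\<^sub>W(u,x\<^sub>2) w\<close> are bounded above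
  uniformly in \<open>w\<close>. As \<open>\<S>\<close> is constant, \<open>P(x\<^sub>1,x\<^sub>2) = (x\<^sub>1 - x\<^sub>2)^k Y\<^sub>W(v,x\<^sub>1) Y\<^sub>W(u,x\<^sub>2) w\<close> equals
  \<open>(x\<^sub>1 - x\<^sub>2)^k \<Sum>i Y\<^sub>W(u\<^sup>(\<^sup>i\<^sup>),x\<^sub>2) Y\<^sub>W(v\<^sup>(\<^sup>i\<^sup>),x\<^sub>1) w\<close> for large \<open>k\<close>, so that in \<open>\<alpha> P\<close> the powers of
  both variables are bounded above; being also bounded below for each \<open>w\<close>, \<open>\<alpha> P\<close> is a Laurent
  polynomial. Dividing by \<open>(x\<^sub>1 - x\<^sub>2)^k\<close> shows that \<open>D(W)\<close> is stable. Under \<open>x\<^sub>i \<mapsto> 1/x\<^sub>i\<close> the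
  substitution \<open>x\<^sub>1 = x\<^sub>2/(1 + z x\<^sub>2)\<close> becomes \<open>x\<^sub>1 = x\<^sub>2 + z\<close>, and for a Laurent polynomial
  \<open>P(x\<^sub>2, x\<^sub>2 + z)\<close> can be read off from \<open>P(x\<^sub>2 + z, x\<^sub>2)\<close> by translation, which is how
  \<open>e\<^sup>z\<^sup>D Y(v,-z) u\<close> enters.

  The \<open>\<S>\<close>-commutativity on \<open>W\<close> follows in the same way from weak associativity on \<open>W\<close> and the
  skew symmetry \<open>\<Sum>i Y(u\<^sup>(\<^sup>i\<^sup>),x) v\<^sup>(\<^sup>i\<^sup>) = e\<^sup>x\<^sup>D Y(v,-x) u\<close> in \<open>V\<close>.
\<close>

section \<open>Binomial identities\<close>

lemma gbinomial_Vandermonde_atMost: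
  fixes a b :: "'a::field_char_0"
  shows "(\<Sum>i\<le>p. (a gchoose i) * (b gchoose (p - i))) = (a + b) gchoose p"
  using gbinomial_Vandermonde[of a b p] by (simp add: atMost_atLeast0)

text \<open>Negating the upper argument of the second factor gives
  \<open>(p - t - 1) gchoose (p - l)\<close> up to sign. Its upper argument is free of
  \<open>l\<close>, so Vandermonde applies, and a second negation removes the sign.\<close>

lemma gbinomial_alternating_sum:
  fixes r t :: "'a::field_char_0"
  shows "(\<Sum>l\<le>p. (- 1) ^ l * (r gchoose l) * ((t - of_nat l) gchoose (p - l))) = (t - r) gchoose p"
proof -
  have "(- 1) ^ l * (r gchoose l) * ((t - of_nat l) gchoose (p - l))
      = (- 1) ^ p * ((r gchoose l) * ((of_nat p - t - 1) gchoose (p - l)))" if "l \<le> p" for l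
  proof -
    have "(t - of_nat l) gchoose (p - l) = (- 1) ^ (p - l) * ((of_nat p - t - 1) gchoose (p - l))"
      using that by (subst gbinomial_negated_upper) (simp add: of_nat_diff algebra_simps)
    moreover have "(- 1 :: 'a) ^ p = (- 1) ^ l * (- 1) ^ (p - l)"
      using that by (metis le_add_diff_inverse power_add)
    ultimately show ?thesis by simp
  qed
  then have "(\<Sum>l\<le>p. (- 1) ^ l * (r gchoose l) * ((t - of_nat l) gchoose (p - l)))
      = (- 1) ^ p * (\<Sum>l\<le>p. (r gchoose l) * ((of_nat p - t - 1) gchoose (p - l)))"
    unfolding sum_distrib_left by (intro sum.cong[OF refl]) (simp only: atMost_iff)
  also have "\<dots> = (- 1) ^ p * ((of_nat p - (t - r) - 1) gchoose p)"
    unfolding gbinomial_Vandermonde_atMost by (simp add: algebra_simps)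
  also have "\<dots> = (t - r) gchoose p"
    by (rule gbinomial_negated_upper[symmetric])
  finally show ?thesis .
qed

lemma minus_one_powi_diff: "(- 1) powi (a - int j) = ((- 1) powi a * (- 1) ^ j :: complex)"
  by (cases "even j") (simp_all add: power_int_diff)


section \<open>Powers of the associates\<close>

text \<open>A homomorphism from the integers is determined by its value at 1. This gives all integer
  powers of an associate, negative ones included, from one closed formula.\<close>

lemma power_int_of_hom:
  fixes e :: "int \<Rightarrow> 'a::division_ring fps"
  assumes "e 0 = 1" and add: "\<And>m n. e (m + n) = e m * e n"
  shows "e 1 powi m = e m"
proof -
  have pow: "e 1 ^ n = e (int n)" for n
    by (induction n) (simp_all add: assms(1) flip: add)
  show ?thesis
  proof (cases "m \<ge> 0")
    case True
    then show ?thesis by (simp add: power_int_def pow)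
  next
    case False
    have "inverse (e 1) = e (- 1)"
      by (rule fps_inverse_unique) (simp add: assms(1) flip: add)
    moreover have "e (- 1) ^ n = e (- int n)" for n
      by (induction n) (simp_all add: assms(1) algebra_simps flip: add)
    ultimately show ?thesis using False by (simp add: power_int_def)
  qed
qed

text \<open>The series \<open>x^m (1 + z x^d)^(c m)\<close>: it is \<open>(x + z)^m\<close> for
  \<open>c = 1, d = - 1\<close> and \<open>(x / (1 + z x))^m\<close> for \<open>c = - 1, d = 1\<close>.\<close>

definition assoc_power :: "int \<Rightarrow> int \<Rightarrow> int \<Rightarrow> complex fls fps"
  where "assoc_power c d m =
    Abs_fps (\<lambda>p. fls_const (of_int (c * m) gchoose p) * fls_X_intpow (m + d * int p))"

lemma fls_const_sum: "(\<Sum>i\<in>A. fls_const (f i)) = fls_const (\<Sum>i\<in>A. f i)"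
  by (induction A rule: infinite_finite_induct) (simp_all add: fls_plus_const)

text \<open>In each power of \<open>z\<close> this is Vandermonde's identity, the exponents of
  \<open>x\<close> adding up to the same value in every summand.\<close>

lemma assoc_power_add: "assoc_power c d (m + n) = assoc_power c d m * assoc_power c d n"
proof (rule fps_ext)
  fix p
  have "fps_nth (assoc_power c d m * assoc_power c d n) p
      = (\<Sum>i\<le>p. fls_const ((of_int (c * m) gchoose i) * (of_int (c * n) gchoose (p - i)))
          * fls_X_intpow (m + n + d * int p))"
    unfolding fps_mult_nth atMost_atLeast0
  proof (rule sum.cong[OF refl])
    fix i assume i: "i \<in> {0..p}"
    have *: "fls_X_intpow (m + d * int i) * fls_X_intpow (n + d * int (p - i))
        = (fls_X_intpow (m + n + d * int p) :: complex fls)"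
      using i unfolding fls_X_intpow_times_fls_X_intpow
      by (simp add: of_nat_diff algebra_simps)
    then show "fps_nth (assoc_power c d m) i * fps_nth (assoc_power c d n) (p - i)
        = fls_const ((of_int (c * m) gchoose i) * (of_int (c * n) gchoose (p - i)))
          * fls_X_intpow (m + n + d * int p)"
      unfolding assoc_power_def fps_nth_Abs_fps fls_const_mult_const[symmetric] *[symmetric]
      by (simp only: ac_simps)
  qed
  also have "\<dots> = fps_nth (assoc_power c d (m + n)) p"
    unfolding sum_distrib_right[symmetric] assoc_power_def fls_const_sum gbinomial_Vandermonde_atMost
    by (simp add: algebra_simps)
  finally show "fps_nth (assoc_power c d (m + n)) p
    = fps_nth (assoc_power c d m * assoc_power c d n) p" ..
qed

lemma assoc_power_0: "assoc_power c d 0 = 1"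
  by (rule fps_ext) (simp add: assoc_power_def gbinomial_0_left fps_one_nth)

lemma zx_coeff_assoc_power:
  "zx_coeff (assoc_power c d m) (p, q) =
    (if p \<ge> 0 \<and> q = m + d * p then of_int (c * m) gchoose nat p else 0)"
  by (simp add: zx_coeff_def assoc_power_def fls_X_intpow_times_conv_shift)

lemma gbinomial_1_eq_0: "p > 1 \<Longrightarrow> (1 :: complex) gchoose p = 0"
  using binomial_gbinomial[of 1 p, where ?'a = complex] by (simp add: binomial_eq_0 del: One_nat_def)

lemma phi_add_eq: "phi_add = assoc_power 1 (- 1) 1"
  by (rule fps_ext, rule fls_eqI)
     (auto simp: phi_add_def assoc_power_def fls_X_intpow_times_conv_shift fps_X_def
       gbinomial_1_eq_0)

lemma phi_add_powi: "phi_add powi m = assoc_power 1 (- 1) m"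
  unfolding phi_add_eq by (rule power_int_of_hom[OF assoc_power_0 assoc_power_add])

lemma phi_inv_mult: "phi_inv * (1 + fps_X * fps_const fls_X) = fps_const fls_X"
proof -
  have "(1 + fps_X * fps_const fls_X :: complex fls fps) $ 0 \<noteq> 0"
    by simp
  then show ?thesis
    unfolding phi_inv_def by (simp add: fps_divide_unit mult.assoc inverse_mult_eq_1)
qed

text \<open>\<open>assoc_power (- 1) 1 (- 1)\<close> is \<open>x^(-1) (1 + z x)\<close>, so the
  candidate times the denominator of \<open>phi_inv\<close> is \<open>x\<close>; the nonzero
  denominator is then cancelled.\<close>

lemma phi_inv_eq: "phi_inv = assoc_power (- 1) 1 1"
proof -
  have "assoc_power (- 1) 1 (- 1) * fps_const fls_X = 1 + fps_X * fps_const fls_X"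
    by (rule fps_ext, rule fls_eqI)
       (auto simp: assoc_power_def fls_X_intpow_times_conv_shift fps_X_def gbinomial_1_eq_0
         fls_X_times_conv_shift)
  then have "assoc_power (- 1) 1 1 * (1 + fps_X * fps_const fls_X)
      = assoc_power (- 1) 1 (1 + - 1) * fps_const fls_X"
    by (metis assoc_power_add mult.assoc)
  then have "phi_inv * (1 + fps_X * fps_const fls_X)
      = assoc_power (- 1) 1 1 * (1 + fps_X * fps_const fls_X)"
    by (simp add: phi_inv_mult assoc_power_0)
  moreover have "(1 + fps_X * fps_const fls_X :: complex fls fps) \<noteq> 0"
    by (rule fps_nonzeroI[of _ 0]) simp
  ultimately show ?thesis
    using mult_right_cancel by blast
qed

lemma phi_inv_powi: "phi_inv powi m = assoc_power (- 1) 1 m"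
  unfolding phi_inv_eq by (rule power_int_of_hom[OF assoc_power_0 assoc_power_add])

lemma zx_coeff_phi_add_diff_power:
  "zx_coeff ((phi_add - fps_const fls_X) ^ k) pq = (if pq = (int k, 0) then 1 else 0)"
  by (cases pq) (auto simp: phi_add_def zx_coeff_def fps_X_power_nth)

text \<open>From \<open>phi - x = - z x phi\<close> the power equals
  \<open>(-1)^k z^k x^k phi^k\<close>, where \<open>phi^k = x^k (1 + z x)^(-k)\<close>.\<close>

lemma zx_coeff_phi_inv_diff_power:
  "zx_coeff ((phi_inv - fps_const fls_X) ^ k) (p, q) =
    (if p \<ge> int k \<and> q = p + int k then (- 1) ^ k * (- of_nat k gchoose nat (p - int k)) else 0)"
proof -
  have "phi_inv - fps_const fls_X = - (fps_X * (fps_const fls_X * phi_inv))"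
    using phi_inv_mult by (simp add: algebra_simps)
  then have "(phi_inv - fps_const fls_X) ^ k = (fps_X * (fps_const (- fls_X) * phi_inv)) ^ k"
    by (simp add: fps_const_neg[symmetric] del: fps_const_neg)
  also have "\<dots> = fps_X ^ k * (fps_const ((- fls_X) ^ k) * phi_inv powi int k)"
    by (simp add: power_mult_distrib)
  also have "(- fls_X :: complex fls) ^ k = fls_const ((- 1) ^ k) * fls_X_intpow (int k)"
    by (simp add: power_minus[of fls_X] fls_X_power_conv_shift_1 fls_const_power)
  finally have "fps_nth ((phi_inv - fps_const fls_X) ^ k) p = (if p < k then 0 else
      fls_const ((- 1) ^ k * (- of_nat k gchoose (p - k)))
        * (fls_X_intpow (int k) * fls_X_intpow (int p)))" for p
    unfolding phi_inv_powi fls_const_mult_const[symmetric]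
    by (simp add: fps_X_power_mult_nth assoc_power_def ac_simps)
  then show ?thesis
    unfolding fls_X_intpow_times_fls_X_intpow
    by (auto simp: zx_coeff_def fls_X_intpow_times_conv_shift nat_diff_distrib)
qed


section \<open>Linear maps and finitely supported sums\<close>

lemma clinear_iff:
  "clinear f \<longleftrightarrow> (\<forall>x y. f (x + y) = f x + f y) \<and> (\<forall>a x. f (a *\<^sub>C x) = a *\<^sub>C f x)"
  by (auto simp: Vector_Spaces.linear_iff cvec.vector_space_axioms)

lemma clinear_add: "clinear f \<Longrightarrow> f (x + y) = f x + f y"
  and clinear_scale: "clinear f \<Longrightarrow> f (a *\<^sub>C x) = a *\<^sub>C f x"
  by (simp_all add: clinear_iff)

lemma clinear_0: "clinear f \<Longrightarrow> f 0 = 0"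
  using clinear_scale[of f 0 0] by simp

lemma clinear_diff: "clinear f \<Longrightarrow> f (x - y) = f x - f y"
  by (metis add_diff_cancel clinear_add diff_add_cancel)

lemma clinear_sum: "clinear f \<Longrightarrow> f (\<Sum>i\<in>A. g i) = (\<Sum>i\<in>A. f (g i))"
  by (induction A rule: infinite_finite_induct) (simp_all add: clinear_0 clinear_add)

lemma clinear_sum_list: "clinear f \<Longrightarrow> f (\<Sum>x\<leftarrow>xs. g x) = (\<Sum>x\<leftarrow>xs. f (g x))"
  by (induction xs) (simp_all add: clinear_0 clinear_add)

lemma sum_apply: "(\<Sum>i\<in>A. f i) x = (\<Sum>i\<in>A. f i x)"
  by (induction A rule: infinite_finite_induct) simp_all

text \<open>Collapses a sum over exponent tuples to the line carrying its support. \<open>h\<close>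
  matches the two supports bijectively, so they are finite together, and in the infinite case both
  sums are 0.\<close>

lemma Sum_any_inj:
  fixes g :: "'b \<Rightarrow> 'u::comm_monoid_add"
  assumes "inj h" and 0: "\<And>x. x \<notin> range h \<Longrightarrow> g x = 0"
  shows "(\<Sum>x. g x) = (\<Sum>y. g (h y))"
proof -
  have "x \<in> h ` {y. g (h y) \<noteq> 0}" if "g x \<noteq> 0" for x
    using 0[of x] that by (cases "x \<in> range h") auto
  then have "{x. g x \<noteq> 0} = h ` {y. g (h y) \<noteq> 0}"
    by auto
  moreover have "inj_on h {y. g (h y) \<noteq> 0}"
    using assms(1) by (rule inj_on_subset) simp
  ultimately show ?thesis
    unfolding Sum_any.expand_set by (simp only: sum.reindex o_def)
qed

lemma Sum_any_nat:
  fixes g :: "nat \<Rightarrow> 'u::comm_monoid_add"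
  assumes "\<And>j. j > L \<Longrightarrow> g j = 0"
  shows "(\<Sum>j. g j) = (\<Sum>j\<le>L. g j)"
proof (rule Sum_any.expand_superset)
  show "{j. g j \<noteq> 0} \<subseteq> {..L}"
    using assms by (metis (mono_tags, lifting) atMost_iff linorder_not_less mem_Collect_eq subsetI)
qed simp

lemma clinear_Sum_any:
  assumes "clinear f" and "finite {x. g x \<noteq> 0}"
  shows "f (Sum_any g) = Sum_any (\<lambda>x. f (g x))"
proof -
  have "Sum_any (\<lambda>x. f (g x)) = (\<Sum>x\<in>{x. g x \<noteq> 0}. f (g x))"
    using assms by (intro Sum_any.expand_superset) (auto simp: clinear_0)
  then show ?thesis
    by (simp add: Sum_any.expand_set[of g] clinear_sum[OF assms(1)])
qed

lemma eval_clinear: "clinear (\<lambda>f. f w)"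
  by (simp add: clinear_iff scaleC_fun_def)

lemma series_mult_delta:
  fixes F :: "'i::ab_group_add \<Rightarrow> 'u::complex_vector"
  shows "series_mult (\<lambda>x. if x = a then 1 else 0) F n = F (n - a)"
proof -
  have "series_mult (\<lambda>x. if x = a then 1 else 0) F n = Sum_any (\<lambda>x. if x = a then F (n - x) else 0)"
    unfolding series_mult_def by (rule Sum_any.cong) simp
  then show ?thesis by simp
qed


section \<open>Multiplication by powers of \<open>x\<^sub>1 - x\<^sub>2\<close>\<close>

text \<open>A difference of two shifts instead of a sum over exponents, so that facts about the
  \<open>k\<close>-th power follow by induction on \<open>k\<close>.\<close>

definition mult_diff :: "(int \<times> int \<Rightarrow> 'u::ab_group_add) \<Rightarrow> int \<times> int \<Rightarrow> 'u"
  where "mult_diff F = (\<lambda>(m, n). F (m - 1, n) - F (m, n - 1))"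

lemma mult_diff_power_eq:
  fixes F :: "int \<times> int \<Rightarrow> 'u::complex_vector"
  shows "(mult_diff ^^ k) F (m, n) =
    (\<Sum>j\<le>k. ((- 1) ^ j * of_nat (k choose j)) *\<^sub>C F (m - int k + int j, n - int j))"
proof (induction k arbitrary: m n)
  case 0
  then show ?case by simp
next
  case (Suc k)
  define h where "h j = F (m - int k - 1 + int j, n - int j)" for j
  define c where "c j = ((- 1) ^ j :: complex)" for j :: nat
  \<comment> \<open>The added term \<open>j = Suc k\<close> has coefficient 0. Splitting off
    \<open>j = 0\<close> aligns this sum with the next one for Pascal's rule.\<close>
  have "(mult_diff ^^ k) F (m - 1, n) = (\<Sum>j\<le>Suc k. (c j * of_nat (k choose j)) *\<^sub>C h j)"
    by (simp add: Suc.IH h_def c_def algebra_simps)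
  also have "\<dots> = h 0 + (\<Sum>j\<le>k. (c (Suc j) * of_nat (k choose Suc j)) *\<^sub>C h (Suc j))"
    by (subst sum.atMost_Suc_shift) (simp add: c_def)
  finally have 1: "(mult_diff ^^ k) F (m - 1, n) = \<dots>" .
  have 2: "(mult_diff ^^ k) F (m, n - 1) = - (\<Sum>j\<le>k. (c (Suc j) * of_nat (k choose j)) *\<^sub>C h (Suc j))"
    by (simp add: Suc.IH h_def c_def algebra_simps sum_negf[symmetric])
  have "(\<Sum>j\<le>Suc k. (c j * of_nat (Suc k choose j)) *\<^sub>C h j)
      = h 0 + (\<Sum>j\<le>k. (c (Suc j) * of_nat (Suc k choose Suc j)) *\<^sub>C h (Suc j))"
    by (subst sum.atMost_Suc_shift) (simp add: c_def)
  also have "\<dots> = (mult_diff ^^ k) F (m - 1, n) - (mult_diff ^^ k) F (m, n - 1)"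
    unfolding 1 2 by (simp add: distrib_left cvec.scale_left_distrib sum.distrib)
  also have "\<dots> = (mult_diff ^^ Suc k) F (m, n)"
    by (simp add: mult_diff_def[of "(mult_diff ^^ k) F"])
  finally have "(mult_diff ^^ Suc k) F (m, n) = (\<Sum>j\<le>Suc k. (c j * of_nat (Suc k choose j)) *\<^sub>C h j)" ..
  moreover have "h j = F (m - int (Suc k) + int j, n - int j)" for j
    by (simp add: h_def algebra_simps)
  ultimately show ?case
    by (simp only: c_def)
qed

text \<open>The coefficients of \<open>(x1 - x2)^k\<close> live on the exponents
  \<open>(k - j, j)\<close>, and those with \<open>j > k\<close> vanish because \<open>k\<close> is
  a natural number.\<close>

lemma series_mult_diff_power:
  fixes F :: "int \<times> int \<Rightarrow> 'u::complex_vector"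
  shows "series_mult (\<lambda>(m, n). diff_power (int k) m n) F = (mult_diff ^^ k) F"
proof
  fix mn :: "int \<times> int"
  obtain m n where mn: "mn = (m, n)" by (cases mn)
  define g where "g = (\<lambda>x. (case x of (m, n) \<Rightarrow> diff_power (int k) m n) *\<^sub>C F (mn - x))"
  define h where "h j = (int k - int j, int j)" for j :: nat
  have "Sum_any g = (\<Sum>j. g (h j))"
  proof (rule Sum_any_inj)
    show "inj h" by (rule injI) (simp add: h_def)
    fix x assume x: "x \<notin> range h"
    obtain a b where ab: "x = (a, b)" by (cases x)
    have "\<not> (b \<ge> 0 \<and> a + b = int k)"
    proof
      assume "b \<ge> 0 \<and> a + b = int k"
      then have "x = h (nat b)" by (simp add: h_def ab)
      then show False using x by blast
    qed
    then show "g x = 0" by (auto simp: g_def ab diff_power_def)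
  qed
  also have "\<dots> = (\<Sum>j\<le>k. g (h j))"
    by (rule Sum_any_nat) (simp add: g_def h_def diff_power_def binomial_gbinomial[symmetric])
  finally show "series_mult (\<lambda>(m, n). diff_power (int k) m n) F mn = (mult_diff ^^ k) F mn"
    by (simp add: series_mult_def mult_diff_power_eq g_def h_def diff_power_def mn
        binomial_gbinomial[symmetric] algebra_simps)
qed

lemma regularized_product_eq:
  "regularized_product YW k u v w = (mult_diff ^^ k) (\<lambda>(m, n). YW u m (YW v n w))"
  unfolding regularized_product_def by (rule series_mult_diff_power)

text \<open>Carries the bound as a parameter, which later provides explicit finite ranges of
  summation.\<close>

definition bounded_below :: "int \<Rightarrow> (int \<times> int \<Rightarrow> 'u::zero) \<Rightarrow> bool"
  where "bounded_below N F \<longleftrightarrow> (\<forall>m n. m < N \<or> n < N \<longrightarrow> F (m, n) = 0)"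

lemma laurent2_on_UNIV_iff: "laurent2_on UNIV F \<longleftrightarrow> (\<exists>N. bounded_below N F)"
  by (simp add: laurent2_on_def bounded_below_def)

lemma bounded_below_mono: "bounded_below N F \<Longrightarrow> N' \<le> N \<Longrightarrow> bounded_below N' F"
  by (auto simp: bounded_below_def)

lemma bounded_below_mult_diff: "bounded_below N F \<Longrightarrow> bounded_below N (mult_diff F)"
  by (auto simp: bounded_below_def mult_diff_def)

text \<open>Under \<open>x1 -> 1/x2\<close>, \<open>x2 -> 1/x1\<close> the factor
  \<open>x1 - x2\<close> becomes \<open>(x1 - x2) / (x1 x2)\<close>. Exchanging the variables while
  inverting them avoids a sign, and the denominators shift both exponents by
  \<open>k\<close>.\<close>

lemma mult_diff_power_reflect:
  "(mult_diff ^^ k) (\<lambda>(m, n). F (- n, - m)) (m, n) = (mult_diff ^^ k) F (int k - n, int k - m)"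
  by (induction k arbitrary: m n) (simp_all add: mult_diff_def algebra_simps)

lemma mult_diff_power_linear:
  assumes "clinear f"
  shows "f ((mult_diff ^^ k) F x) = (mult_diff ^^ k) (f \<circ> F) x"
  by (induction k arbitrary: x) (auto simp: mult_diff_def clinear_diff[OF assms])

lemma mult_diff_power_eq_0_fst:
  assumes "\<And>m n. m > M \<Longrightarrow> F (m, n) = 0" and "m > M + int k"
  shows "(mult_diff ^^ k) F (m, n) = 0"
  using assms(2) by (induction k arbitrary: m n) (simp_all add: assms(1) mult_diff_def)

lemma mult_diff_power_in_subspace:
  assumes "cvec.subspace S" and "\<And>x. F x \<in> S"
  shows "(mult_diff ^^ k) F x \<in> S"
proof (induction k arbitrary: x)
  case (Suc k)
  then show ?case by (cases x) (simp add: mult_diff_def cvec.subspace_diff[OF assms(1)])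
qed (simp add: assms(2))

lemma bounded_below_mult_diff_power: "bounded_below N F \<Longrightarrow> bounded_below N ((mult_diff ^^ k) F)"
  by (induction k) (simp_all add: bounded_below_mult_diff)

text \<open>Multiplication by \<open>x\<^sub>1 - x\<^sub>2\<close> is homogeneous and injective on series whose powers of
  \<open>x\<^sub>1\<close> are bounded above, so vanishing in high total degree can be divided out.\<close>

lemma mult_diff_cancel_total_degree:
  assumes M: "\<And>m n. m > M \<Longrightarrow> F (m, n) = 0"
    and T: "\<And>m n. m + n > T + 1 \<Longrightarrow> mult_diff F (m, n) = 0"
    and "m + n > T"
  shows "F (m, n) = 0"
proof -
  \<comment> \<open>Since the product vanishes in degree \<open>s + 1\<close>, \<open>F\<close> is
    constant along the line of degree \<open>s\<close>; far enough along it the first exponent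
    exceeds \<open>M\<close>.\<close>
  have "F (m, s - m) = F (m + int i, s - m - int i)" if "s > T" for s i
  proof (induction i)
    case (Suc i)
    show ?case
      using Suc T[of "m + int i + 1" "s - m - int i"] that by (simp add: mult_diff_def algebra_simps)
  qed simp
  from this[of "m + n" "nat (M + 1 - m)"] show ?thesis
    using M[of "m + int (nat (M + 1 - m))"] assms(3) by simp
qed

lemma mult_diff_power_cancel_total_degree:
  assumes M: "\<And>m n. m > M \<Longrightarrow> F (m, n) = 0"
    and "\<And>m n. m + n > T + int k \<Longrightarrow> (mult_diff ^^ k) F (m, n) = 0"
    and "m + n > T"
  shows "F (m, n) = 0"
  using assms(2,3)
proof (induction k arbitrary: T m n)
  case (Suc k)
  have "(mult_diff ^^ k) F (m, n) = 0" if "m + n > T + int k" for m n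
  proof (rule mult_diff_cancel_total_degree[where M = "M + int k" and T = "T + int k"])
    show "(mult_diff ^^ k) F (m, n) = 0" if "m > M + int k" for m n
      using M that by (rule mult_diff_power_eq_0_fst)
    show "mult_diff ((mult_diff ^^ k) F) (m, n) = 0" if "m + n > T + int k + 1" for m n
      using Suc.prems(1)[of m n] that by simp
  qed (use that in simp)
  then show ?case using Suc.IH Suc.prems(2) by blast
qed simp


section \<open>The substitution \<open>x\<^sub>1 = x\<^sub>2 + z\<close>\<close>

text \<open>The coefficient of \<open>z^p x\<^sub>2^(s-p)\<close> in \<open>F(x\<^sub>2 + z, x\<^sub>2)\<close>.\<close>

definition diag_coeff :: "nat \<Rightarrow> int \<Rightarrow> (int \<times> int \<Rightarrow> 'u::complex_vector) \<Rightarrow> 'u"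
  where "diag_coeff p s F = (\<Sum>m. (of_int m gchoose p) *\<^sub>C F (m, s - m))"

lemma diag_coeff_eq_sum:
  assumes "bounded_below N F"
  shows "diag_coeff p s F = (\<Sum>m\<in>{N..s - N}. (of_int m gchoose p) *\<^sub>C F (m, s - m))"
  unfolding diag_coeff_def
proof (rule Sum_any.expand_superset)
  show "{m. (of_int m gchoose p) *\<^sub>C F (m, s - m) \<noteq> 0} \<subseteq> {N..s - N}"
    using assms by (force simp: bounded_below_def)
qed simp

text \<open>Treats both associates at once. The coefficient of \<open>z^p\<close> in
  \<open>phi^m\<close> is a multiple of the single monomial \<open>x^(m + d p)\<close>, so each
  \<open>m\<close> admits only one \<open>n\<close>.\<close>

lemma subst_phi_assoc_power:
  fixes F :: "int \<times> int \<Rightarrow> 'u::complex_vector"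
  assumes "\<And>m. phi powi m = assoc_power c d m"
  shows "subst_phi phi F (p, q) = (if p < 0 then 0 else
    (\<Sum>m. (of_int (c * m) gchoose nat p) *\<^sub>C F (m, q - m - d * p)))"
proof -
  define g where "g = (\<lambda>(m, n). zx_coeff (phi powi m) (p, q - n) *\<^sub>C F (m, n))"
  have "subst_phi phi F (p, q) = (\<Sum>x. g x)"
    by (simp add: subst_phi_def g_def)
  also have "\<dots> = (\<Sum>m. g (m, q - m - d * p))"
  proof (rule Sum_any_inj)
    show "inj (\<lambda>m. (m, q - m - d * p))" by (rule injI) simp
    fix x assume x: "x \<notin> range (\<lambda>m. (m, q - m - d * p))"
    obtain a b where ab: "x = (a, b)" by (cases x)
    then have "b \<noteq> q - a - d * p" using x by auto
    then show "g x = 0" by (auto simp: g_def ab assms zx_coeff_assoc_power)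
  qed
  also have "\<dots> = (if p < 0 then 0 else
    (\<Sum>m. (of_int (c * m) gchoose nat p) *\<^sub>C F (m, q - m - d * p)))"
    by (auto simp: g_def assms zx_coeff_assoc_power)
  finally show ?thesis .
qed

lemma subst_phi_add:
  "subst_phi phi_add F (p, q) = (if p < 0 then 0 else diag_coeff (nat p) (q + p) F)"
  by (simp add: subst_phi_assoc_power[OF phi_add_powi] diag_coeff_def algebra_simps)

lemma subst_phi_inv:
  fixes F :: "int \<times> int \<Rightarrow> 'u::complex_vector"
  shows "subst_phi phi_inv F (p, q) = (if p < 0 then 0 else
    (\<Sum>m. (- of_int m gchoose nat p) *\<^sub>C F (m, q - p - m)))"
  by (simp add: subst_phi_assoc_power[OF phi_inv_powi] algebra_simps)

text \<open>On \<open>x1 = x2 + z\<close> the factor \<open>x1 - x2\<close> is \<open>z\<close>. For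
  the coefficients this is Pascal's rule.\<close>

lemma diag_coeff_mult_diff:
  assumes "bounded_below N F"
  shows "diag_coeff p (s + 1) (mult_diff F) = (if p = 0 then 0 else diag_coeff (p - 1) s F)"
proof -
  have "(\<Sum>m\<in>{N..s + 1 - N}. (of_int m gchoose p) *\<^sub>C F (m - 1, s + 1 - m))
      = (\<Sum>m\<in>{N - 1..s - N}. (of_int (m + 1) gchoose p) *\<^sub>C F (m, s - m))"
    by (rule sum.reindex_bij_witness[of _ "\<lambda>m. m + 1" "\<lambda>m. m - 1"]) (auto simp: algebra_simps)
  also have "\<dots> = (\<Sum>m\<in>{N..s - N}. (of_int (m + 1) gchoose p) *\<^sub>C F (m, s - m))"
    using assms by (intro sum.mono_neutral_right) (auto simp: bounded_below_def)
  finally have 1: "(\<Sum>m\<in>{N..s + 1 - N}. (of_int m gchoose p) *\<^sub>C F (m - 1, s + 1 - m))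
      = (\<Sum>m\<in>{N..s - N}. (of_int (m + 1) gchoose p) *\<^sub>C F (m, s - m))" .
  have 2: "(\<Sum>m\<in>{N..s + 1 - N}. (of_int m gchoose p) *\<^sub>C F (m, s - m))
      = (\<Sum>m\<in>{N..s - N}. (of_int m gchoose p) *\<^sub>C F (m, s - m))"
    using assms by (intro sum.mono_neutral_right) (auto simp: bounded_below_def)
  have "diag_coeff p (s + 1) (mult_diff F)
      = (\<Sum>m\<in>{N..s - N}. ((of_int (m + 1) gchoose p) - (of_int m gchoose p)) *\<^sub>C F (m, s - m))"
    unfolding diag_coeff_eq_sum[OF bounded_below_mult_diff[OF assms]]
    using 1 2 by (simp add: mult_diff_def cvec.scale_right_diff_distrib cvec.scale_left_diff_distrib
        sum_subtractf)
  also have "\<dots> = (if p = 0 then 0 else diag_coeff (p - 1) s F)"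
    unfolding diag_coeff_eq_sum[OF assms]
    by (cases p) (simp_all add: gbinomial_Suc_Suc)
  finally show ?thesis .
qed

lemma diag_coeff_mult_diff_power:
  assumes "bounded_below N F"
  shows "diag_coeff (p + k) (s + int k) ((mult_diff ^^ k) F) = diag_coeff p s F"
proof (induction k)
  case (Suc k)
  then show ?case
    using diag_coeff_mult_diff[OF bounded_below_mult_diff_power[OF assms, of k], of "p + Suc k" "s + int k"]
    by (simp add: algebra_simps)
qed simp

text \<open>Substituting \<open>x\<^sub>2 = x\<^sub>1 - z\<close> instead of \<open>x\<^sub>1 = x\<^sub>2 + z\<close> amounts to a translation of the
  remaining variable.\<close>

lemma diag_coeff_swap:
  assumes "bounded_below N F"
  shows "(\<Sum>j\<le>p. ((- 1) ^ (p - j) * (of_int (s - int p + int j) gchoose j)) *\<^sub>C diag_coeff (p - j) s F)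
    = diag_coeff p s (F \<circ> prod.swap)"
proof -
  let ?A = "{N..s - N}"
  have N': "bounded_below N (F \<circ> prod.swap)"
    using assms by (auto simp: bounded_below_def)
  have "(\<Sum>j\<le>p. ((- 1) ^ (p - j) * (of_int (s - int p + int j) gchoose j)) *\<^sub>C diag_coeff (p - j) s F)
     = (\<Sum>m\<in>?A. (\<Sum>j\<le>p. (- 1) ^ (p - j) * (of_int (s - int p + int j) gchoose j) * (of_int m gchoose (p - j)))
          *\<^sub>C F (m, s - m))"
    unfolding diag_coeff_eq_sum[OF assms]
    by (simp add: cvec.scale_sum_right cvec.scale_sum_left) (rule sum.swap)
  also have "\<dots> = (\<Sum>m\<in>?A. (of_int (s - m) gchoose p) *\<^sub>C F (m, s - m))"
  proof (intro sum.cong refl arg_cong2[where f = scaleC])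
    fix m
    \<comment> \<open>Reversing the sum gives the alternating form with \<open>t = s\<close> and
      \<open>r = m\<close>. Its value has upper argument \<open>s - m\<close>, the exponent of the
      other variable.\<close>
    have "(\<Sum>j\<le>p. (- 1) ^ (p - j) * (of_int (s - int p + int j) gchoose j) * (of_int m gchoose (p - j)))
       = (\<Sum>l\<le>p. (- 1) ^ l * (of_int m gchoose l) * ((of_int s - of_nat l :: complex) gchoose (p - l)))"
      by (rule sum.reindex_bij_witness[of _ "\<lambda>l. p - l" "\<lambda>l. p - l"])
         (auto simp: of_nat_diff algebra_simps)
    then show "(\<Sum>j\<le>p. (- 1) ^ (p - j) * (of_int (s - int p + int j) gchoose j) * (of_int m gchoose (p - j)))
       = (of_int (s - m) gchoose p :: complex)"
      by (simp add: gbinomial_alternating_sum)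
  qed
  also have "\<dots> = (\<Sum>m\<in>?A. (of_int m gchoose p) *\<^sub>C F (s - m, m))"
    by (rule sum.reindex_bij_witness[of _ "\<lambda>m. s - m" "\<lambda>m. s - m"]) auto
  finally show ?thesis
    by (simp add: diag_coeff_eq_sum[OF N'])
qed

text \<open>On \<open>x1 = x2 + z\<close> this multiplies \<open>F\<close> by
  \<open>(1 + z / x2)^c = (x1 / x2)^c\<close>, which replaces the weight exponent \<open>m\<close>
  by \<open>m + c\<close>; in coefficients it is Vandermonde.\<close>

lemma diag_coeff_translate:
  assumes F: "bounded_below N F"
  shows "(\<Sum>i\<le>p. (c gchoose i) *\<^sub>C diag_coeff (p - i) s F)
    = (\<Sum>m\<in>{N..s - N}. ((of_int m + c) gchoose p) *\<^sub>C F (m, s - m))"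
proof -
  have "(\<Sum>i\<le>p. (c gchoose i) *\<^sub>C diag_coeff (p - i) s F) = (\<Sum>m\<in>{N..s - N}.
      (\<Sum>i\<le>p. (c gchoose i) * (of_int m gchoose (p - i))) *\<^sub>C F (m, s - m))"
    unfolding diag_coeff_eq_sum[OF F]
    by (simp add: cvec.scale_sum_right cvec.scale_sum_left) (rule sum.swap)
  then show ?thesis
    by (simp add: gbinomial_Vandermonde_atMost add.commute)
qed

text \<open>Injectivity of the substitution \<open>x1 = x2 + z\<close>. In a fixed total degree only
  finitely many coefficients occur, and translating by \<open>- N\<close> makes their weights
  ordinary binomial coefficients, a triangular system.\<close>

lemma diag_coeff_eq_0_imp:
  assumes F: "bounded_below N F" and 0: "\<And>p s. diag_coeff p s F = 0"
  shows "F (m, n) = 0"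
proof (rule ccontr)
  assume nz: "F (m, n) \<noteq> 0"
  define s where "s = m + n"
  define A where "A = {m \<in> {N..s - N}. F (m, s - m) \<noteq> 0}"
  define a where "a = Max A"
  have "m \<ge> N" "n \<ge> N"
    using nz F unfolding bounded_below_def by (meson not_le)+
  then have "m \<in> A"
    using nz by (simp add: A_def s_def)
  moreover have "finite A"
    by (rule finite_subset[of _ "{N..s - N}"]) (auto simp: A_def)
  ultimately have a: "a \<in> A" and max: "\<And>i. i \<in> A \<Longrightarrow> i \<le> a"
    unfolding a_def using Max_in by auto
  \<comment> \<open>With this \<open>p\<close> the weight is 0 at exponents below the largest one
    \<open>a\<close> and 1 at \<open>a\<close> itself.\<close>
  define p where "p = nat (a - N)"
  have "0 = (\<Sum>i\<le>p. (of_int (- N) gchoose i) *\<^sub>C diag_coeff (p - i) s F)"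
    by (simp add: 0)
  also have "\<dots> = (\<Sum>m\<in>{N..s - N}. (of_nat (nat (m - N) choose p)) *\<^sub>C F (m, s - m))"
    unfolding diag_coeff_translate[OF F]
    by (intro sum.cong refl) (simp add: binomial_gbinomial)
  also have "\<dots> = (\<Sum>m\<in>{a}. (of_nat (nat (m - N) choose p)) *\<^sub>C F (m, s - m))"
  proof (intro sum.mono_neutral_right ballI)
    fix i assume i: "i \<in> {N..s - N} - {a}"
    show "of_nat (nat (i - N) choose p) *\<^sub>C F (i, s - i) = 0"
    proof (cases "i \<in> A")
      case True
      then have "nat (i - N) < p" using max[of i] i by (auto simp: p_def)
      then show ?thesis by (simp add: binomial_eq_0)
    qed (use i in \<open>auto simp: A_def\<close>)
  qed (use a in \<open>auto simp: A_def\<close>)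
  also have "\<dots> = F (a, s - a)" by (simp add: p_def)
  finally show False using a by (simp add: A_def)
qed

lemma diag_coeff_linear:
  assumes "clinear f" and "bounded_below N F"
  shows "f (diag_coeff p s F) = diag_coeff p s (f \<circ> F)"
proof -
  have "bounded_below N (f \<circ> F)"
    using assms by (auto simp: bounded_below_def clinear_0)
  then show ?thesis
    using assms by (simp add: diag_coeff_eq_sum clinear_sum clinear_scale)
qed

lemma diag_coeff_diff:
  assumes "bounded_below N F" and "bounded_below N' G"
  shows "diag_coeff p s (\<lambda>x. F x - G x) = diag_coeff p s F - diag_coeff p s G"
proof -
  have FG: "bounded_below (min N N') F" "bounded_below (min N N') G"
    using assms by (auto intro: bounded_below_mono)
  then have "bounded_below (min N N') (\<lambda>x. F x - G x)"
    by (auto simp: bounded_below_def)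
  with FG show ?thesis
    by (simp add: diag_coeff_eq_sum cvec.scale_right_diff_distrib sum_subtractf)
qed

text \<open>The bound is part of the induction because the additivity step rewrites
  \<open>diag_coeff\<close> as a sum over a common finite range.\<close>

lemma diag_coeff_sum_list:
  assumes "\<And>t. t \<in> set ts \<Longrightarrow> \<exists>N. bounded_below N (F t)"
  shows "(\<exists>N. bounded_below N (\<lambda>x. \<Sum>t\<leftarrow>ts. F t x)) \<and>
    diag_coeff p s (\<lambda>x. \<Sum>t\<leftarrow>ts. F t x) = (\<Sum>t\<leftarrow>ts. diag_coeff p s (F t))"
  using assms
proof (induction ts)
  case Nil
  show ?case by (simp add: bounded_below_def diag_coeff_def)
next
  case (Cons t ts)
  obtain N where N: "bounded_below N (\<lambda>x. \<Sum>t\<leftarrow>ts. F t x)"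
      "diag_coeff p s (\<lambda>x. \<Sum>t\<leftarrow>ts. F t x) = (\<Sum>t\<leftarrow>ts. diag_coeff p s (F t))"
    using Cons by auto
  obtain N' where "bounded_below N' (F t)"
    using Cons.prems by auto
  then have M: "bounded_below (min N N') (F t)"
    "bounded_below (min N N') (\<lambda>x. \<Sum>t\<leftarrow>ts. F t x)"
    using N by (auto intro: bounded_below_mono)
  then have "bounded_below (min N N') (\<lambda>x. F t x + (\<Sum>t\<leftarrow>ts. F t x))"
    by (auto simp: bounded_below_def)
  with M show ?case
    unfolding list.map sum_list.Cons N(2)[symmetric]
    by (auto simp: diag_coeff_eq_sum scaleC_add_right sum.distrib)
qed


section \<open>Skew symmetry\<close>

context weak_quantum_vertex_algebra
begin

lemma Y_eventually_0: "\<exists>N. \<forall>n<N. Y u n v = 0"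
  using Y_laurent[of u v] by (auto simp: laurent_on_def)

lemma Y_0 [simp]: "Y u n 0 = 0" "Y 0 n v = 0"
  using clinear_0[OF Y_linear_right] clinear_0[OF Y_linear_left] by auto

lemma D_operator_eq: "D_operator Y vac v = Y v 1 vac"
  by (simp add: D_operator_def formal_deriv_def)

lemma D_operator_power_0 [simp]: "(D_operator Y vac ^^ j) 0 = 0"
  by (induction j) (simp_all add: D_operator_eq)

text \<open>The Jacobi identity applied to \<open>\<one>\<close>, at the exponent \<open>x\<^sub>0^a x\<^sub>1^0 x\<^sub>2^(-1)\<close>: creation
  kills the first term and leaves one summand of the second, which gives
  \<open>\<Sum>i Y(v\<^sup>(\<^sup>i\<^sup>),-x) u\<^sup>(\<^sup>i\<^sup>) = e\<^sup>-\<^sup>x\<^sup>D Y(u,x) v\<close>.\<close>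

lemma S_jacobi_skew_symmetry:
  assumes "S_jacobi Y u v (map (\<lambda>(v', u'). (v', u', 1)) ts)"
  shows "(- 1) powi a *\<^sub>C (\<Sum>(v', u')\<leftarrow>ts. Y v' a u')
    = (\<Sum>j::nat. (- 1) ^ j *\<^sub>C Y (Y u (a - int j) v) (int j) vac)"
proof -
  define J1 where "J1 = series_mult delta_12_0
    (\<lambda>(a, b, c). if a = 0 then Y u b (Y v c vac) else 0)"
  define J2 where "J2 = series_mult delta_21_0 (\<lambda>(a, b, c). if a = 0
        then \<Sum>(v', u', f)\<leftarrow>map (\<lambda>(v', u'). (v', u', 1)) ts.
          series_mult (at_diff_21 f) (\<lambda>(b, c). Y v' c (Y u' b vac)) (b, c) else 0)"
  define J3 where "J3 = series_mult delta_10_2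
    (\<lambda>(a, b, c). if b = 0 then Y (Y u a v) c vac else 0)"
  have "J1 (a, 0, - 1) = 0"
  proof -
    have "delta_12_0 x *\<^sub>C (case (a, 0, - 1) - x of
        (a, b, c) \<Rightarrow> if a = 0 then Y u b (Y v c vac) else 0) = 0" for x
      by (cases x) (auto simp: delta_12_0_def diff_power_def Y_creation)
    then show ?thesis
      by (simp only: J1_def series_mult_def Sum_any.neutral)
  qed
  moreover have "J2 (a, 0, - 1) = - ((- 1) powi a *\<^sub>C (\<Sum>(v', u')\<leftarrow>ts. Y v' a u'))"
  proof -
    have "diff_power 0 i j = (if i = 0 \<and> j = 0 then 1 else 0)" for i j
      by (auto simp: diff_power_def gbinomial_0_left)
    then have "at_diff_21 1 = (\<lambda>x. if x = (0, 0) then 1 else 0)"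
      by (auto simp: at_diff_21_def fun_eq_iff)
    then have "series_mult (at_diff_21 1) F (b, c) = F (b, c)" for F :: "int \<times> int \<Rightarrow> 'v" and b c
      by (simp add: series_mult_delta)
    then have J2: "J2 = series_mult delta_21_0
        (\<lambda>(a, b, c). if a = 0 then \<Sum>(v', u')\<leftarrow>ts. Y v' c (Y u' b vac) else 0)"
      unfolding J2_def by (intro arg_cong[where f = "series_mult delta_21_0"])
        (auto simp: fun_eq_iff o_def case_prod_unfold)
    \<comment> \<open>The kernel requires \<open>b >= 0\<close> and creation requires
      \<open>- b >= 0\<close>, so only \<open>b = 0\<close> remains, where \<open>u'\<close> acting
      on \<open>vac\<close> returns \<open>u'\<close>.\<close>
    have "J2 (a, 0, - 1) = Sum_any (\<lambda>x. if x = (a, 0::int, - a - 1)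
        then (- ((- 1) powi a)) *\<^sub>C (\<Sum>(v', u')\<leftarrow>ts. Y v' a u') else 0)"
      unfolding J2 series_mult_def
    proof (rule Sum_any.cong)
      fix x :: "int \<times> int \<times> int"
      obtain a' b c where x: "x = (a', b, c)" by (cases x)
      have [simp]: "(\<Sum>(v', u')\<leftarrow>ts. (0::'v)) = 0" by (induction ts) auto
      have "(- 1) powi (- a - 1) = (- ((- 1) powi a) :: complex)"
        by (simp add: power_int_minus_left minus_equation_iff)
      then show "delta_21_0 x *\<^sub>C (case (a, 0, - 1) - x of
          (a, b, c) \<Rightarrow> if a = 0 then \<Sum>(v', u')\<leftarrow>ts. Y v' c (Y u' b vac) else 0)
        = (if x = (a, 0, - a - 1) then (- ((- 1) powi a)) *\<^sub>C (\<Sum>(v', u')\<leftarrow>ts. Y v' a u') else 0)"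
        by (cases "b = 0")
          (auto simp: x delta_21_0_def diff_power_def Y_creation)
    qed
    then show ?thesis by simp
  qed
  moreover have "J3 (a, 0, - 1) = (\<Sum>j::nat. (- 1) ^ j *\<^sub>C Y (Y u (a - int j) v) (int j) vac)"
  proof -
    define g where "g = (\<lambda>x. delta_10_2 x *\<^sub>C (case (a, 0, - 1) - x of
      (a, b, c) \<Rightarrow> if b = 0 then Y (Y u a v) c vac else 0))"
    define h where "h j = (int j, 0::int, - 1 - int j)" for j :: nat
    have "J3 (a, 0, - 1) = Sum_any g"
      by (simp add: J3_def series_mult_def g_def)
    also have "\<dots> = Sum_any (\<lambda>j. g (h j))"
    proof (rule Sum_any_inj)
      show "inj h" by (rule injI) (simp add: h_def)
      fix x assume "x \<notin> range h"
      moreover obtain a' b c where x: "x = (a', b, c)" by (cases x)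
      ultimately have "\<not> (a' \<ge> 0 \<and> b = 0 \<and> c = - 1 - a')"
        by (auto simp: h_def image_iff) (metis nonneg_int_cases)
      then show "g x = 0"
        by (auto simp: g_def x delta_10_2_def diff_power_def)
    qed
    also have "\<dots> = (\<Sum>j::nat. (- 1) ^ j *\<^sub>C Y (Y u (a - int j) v) (int j) vac)"
      by (rule Sum_any.cong)
        (simp add: g_def h_def delta_10_2_def diff_power_def binomial_gbinomial[symmetric])
    finally show ?thesis .
  qed
  moreover have "J1 - J2 = J3"
    using assms unfolding S_jacobi_def J1_def J2_def J3_def by blast
  ultimately show ?thesis
    by (metis (no_types, lifting) diff_0 fun_diff_def minus_minus)
qed

end


section \<open>Modules\<close>

locale weak_quantum_vertex_algebra_module = weak_quantum_vertex_algebra Y vac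
  for Y :: "'v::complex_vector \<Rightarrow> int \<Rightarrow> 'v \<Rightarrow> 'v" and vac +
  fixes YW :: "'v \<Rightarrow> int \<Rightarrow> 'w::complex_vector \<Rightarrow> 'w"
  assumes va_module: "va_module Y vac UNIV YW"
begin

lemma YW_linear_left: "clinear (\<lambda>v. YW v n w)"
  and YW_linear_right: "clinear (YW v n)"
  and YW_vacuum: "YW vac n w = (if n = 0 then w else 0)"
  and YW_eventually_0: "\<exists>N. \<forall>n<N. YW v n w = 0"
proof -
  interpret M: phi_coordinated_module phi_add Y vac UNIV YW
    by (rule va_module)
  show "clinear (\<lambda>v. YW v n w)" by (rule M.YW_linear_left) simp
  show "clinear (YW v n)" by (simp add: clinear_iff M.YW_add_right M.YW_scale_right)
  show "YW vac n w = (if n = 0 then w else 0)" by (rule M.YW_vacuum) simp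
  show "\<exists>N. \<forall>n<N. YW v n w = 0" using M.YW_laurent[of w v] by (simp add: laurent_on_def)
qed

lemma YW_0 [simp]: "YW u n 0 = 0" "YW 0 n w = 0"
  using clinear_0[OF YW_linear_right] clinear_0[OF YW_linear_left] by auto

text \<open>\<open>(x\<^sub>1 - x\<^sub>2)^k\<close> clears the denominators of \<open>Y\<^sub>W(u,x\<^sub>1) Y\<^sub>W(v,x\<^sub>2)\<close>, and weak associativity
  holds with this \<open>k\<close>.\<close>

definition assoc_order :: "nat \<Rightarrow> 'v \<Rightarrow> 'v \<Rightarrow> bool"
  where "assoc_order k u v \<longleftrightarrow> (\<forall>w.
    (\<exists>N. bounded_below N (regularized_product YW k u v w)) \<and>
    (\<forall>p q. YW (Y u (p - int k) v) q w =
      (if p < 0 then 0 else diag_coeff (nat p) (q + p) (regularized_product YW k u v w))))"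

lemma assoc_orderD:
  assumes "assoc_order k u v"
  shows "\<exists>N. bounded_below N (regularized_product YW k u v w)"
    and "YW (Y u (p - int k) v) q w =
      (if p < 0 then 0 else diag_coeff (nat p) (q + p) (regularized_product YW k u v w))"
  using assms unfolding assoc_order_def by blast+

text \<open>For \<open>phi_add\<close> the factor \<open>(phi - x)^k\<close> is the monomial
  \<open>z^k\<close>, which becomes the shift \<open>p - int k\<close>.\<close>

lemma assoc_order_exists: "\<exists>k. assoc_order k u v"
proof -
  interpret M: phi_coordinated_module phi_add Y vac UNIV YW
    by (rule va_module)
  obtain k where bdd: "\<And>w. laurent2_on UNIV (regularized_product YW k u v w)"
    and assoc: "\<And>w. subst_phi phi_add (regularized_product YW k u v w) =
      series_mult (zx_coeff ((phi_add - fps_const fls_X) ^ k)) (\<lambda>(p, q). YW (Y u p v) q w)"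
    using M.YW_weak_assoc by blast
  have "zx_coeff ((phi_add - fps_const fls_X) ^ k) = (\<lambda>x. if x = (int k, 0) then 1 else 0)"
    by (rule ext) (rule zx_coeff_phi_add_diff_power)
  then have "subst_phi phi_add (regularized_product YW k u v w) (p, q) = YW (Y u (p - int k) v) q w"
    for p q w
    unfolding assoc by (simp add: series_mult_delta)
  with bdd have "assoc_order k u v"
    by (simp add: assoc_order_def laurent2_on_UNIV_iff subst_phi_add[symmetric])
  then show ?thesis ..
qed

lemma regularized_product_Suc:
  "regularized_product YW (Suc k) u v w = mult_diff (regularized_product YW k u v w)"
  by (simp add: regularized_product_eq)

text \<open>One more factor \<open>x1 - x2\<close> becomes one more \<open>z\<close>. Hence
  \<open>k\<close> may be enlarged, and finitely many pairs can share it.\<close>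

lemma assoc_order_Suc:
  assumes "assoc_order k u v"
  shows "assoc_order (Suc k) u v"
proof -
  let ?P = "regularized_product YW k u v"
  have "YW (Y u (p - int (Suc k)) v) q w = (if p < 0 then 0 else diag_coeff (nat p) (q + p) (mult_diff (?P w)))"
    for p q w
  proof -
    obtain N where N: "bounded_below N (?P w)"
      using assoc_orderD(1)[OF assms] by blast
    have "YW (Y u (p - 1 - int k) v) q w =
      (if p - 1 < 0 then 0 else diag_coeff (nat (p - 1)) (q + (p - 1)) (?P w))"
      using assms by (rule assoc_orderD(2))
    moreover have "diag_coeff (nat p) (q + p) (mult_diff (?P w)) =
      (if nat p = 0 then 0 else diag_coeff (nat p - 1) (q + p - 1) (?P w))"
      using diag_coeff_mult_diff[OF N, of "nat p" "q + p - 1"] by simp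
    moreover have "p - int (Suc k) = p - 1 - int k" by simp
    ultimately show ?thesis
      by (auto simp: nat_diff_distrib algebra_simps)
  qed
  then show ?thesis
    unfolding assoc_order_def regularized_product_Suc
    using assoc_orderD(1)[OF assms] bounded_below_mult_diff by blast
qed

lemma assoc_order_mono: "assoc_order k u v \<Longrightarrow> k \<le> l \<Longrightarrow> assoc_order l u v"
  by (rotate_tac, induction l rule: dec_induct) (simp_all add: assoc_order_Suc)

lemma assoc_order_uniform:
  "finite A \<Longrightarrow> \<exists>k. \<forall>(u, v)\<in>A. assoc_order k u v"
proof (induction A rule: finite_induct)
  case (insert x A)
  then obtain k where k: "\<forall>(u, v)\<in>A. assoc_order k u v"
    by blast
  obtain l where "assoc_order l (fst x) (snd x)"
    using assoc_order_exists by blast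
  with k have "\<forall>(u, v)\<in>insert x A. assoc_order (max k l) u v"
    by (auto intro: assoc_order_mono)
  then show ?case ..
qed simp

section \<open>The vacuum, the operator \<open>D\<close> and the opposite algebra acting on a
  module\<close>

lemma YW_creation:
  "YW (Y t (int j) vac) q w = (of_int (q + int j) gchoose j) *\<^sub>C YW t (q + int j) w"
proof -
  obtain k where k: "assoc_order k t vac"
    using assoc_order_exists by blast
  obtain N where N: "\<forall>n<N. YW t n w = 0"
    using YW_eventually_0 by blast
  \<comment> \<open>As the vacuum acts as the identity, \<open>F\<close> is just
    \<open>Y_W(t,x1) w\<close> and is bounded below without any factor. So
    \<open>(x1 - x2)^k\<close> cancels against \<open>z^k\<close>, leaving
    \<open>Y_W(Y(t,z) vac, x) = Y_W(t, x + z)\<close>.\<close>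
  define F where "F = (\<lambda>(m, n). YW t m (YW vac n w))"
  have "bounded_below (min N 0) F"
    using N by (auto simp: bounded_below_def F_def YW_vacuum)
  have "YW (Y t (int j) vac) q w = YW (Y t (int (j + k) - int k) vac) q w"
    by simp
  also have "\<dots> = diag_coeff (j + k) (q + int (j + k)) (regularized_product YW k t vac w)"
    unfolding assoc_orderD(2)[OF k] by (simp add: nat_add_distrib)
  also have "\<dots> = diag_coeff j (q + int j) F"
    unfolding regularized_product_eq F_def[symmetric]
    using diag_coeff_mult_diff_power[OF \<open>bounded_below _ F\<close>, of j k "q + int j"] by (simp add: add.assoc)
  also have "\<dots> = Sum_any (\<lambda>m. if m = q + int j
      then (of_int (q + int j) gchoose j) *\<^sub>C YW t (q + int j) w else 0)"
    unfolding diag_coeff_def by (rule Sum_any.cong) (auto simp: F_def YW_vacuum)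
  finally show ?thesis by simp
qed

text \<open>\<open>D\<close> acts as \<open>d/dx\<close>, which is the case \<open>j = 1\<close> of
  \<open>YW_creation\<close>; iterating it produces the rising factorial.\<close>

lemma YW_D_power:
  "YW ((D_operator Y vac ^^ j) t) q w = pochhammer (of_int q + 1) j *\<^sub>C YW t (q + int j) w"
proof (induction j arbitrary: q)
  case (Suc j)
  have "YW (D_operator Y vac s) q w = of_int (q + 1) *\<^sub>C YW s (q + 1) w" for s
    using YW_creation[of s 1 q w] by (simp add: D_operator_eq)
  then show ?case
    by (simp add: Suc.IH pochhammer_rec algebra_simps)
qed simp

lemma YW_opposite:
  assumes L: "\<And>j. j > L \<Longrightarrow> Y v (n - int j) u = 0"
  shows "YW (opposite Y vac u n v) q w = (\<Sum>j\<le>L.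
    ((- 1) powi (n - int j) * (of_int (q + int j) gchoose j)) *\<^sub>C YW (Y v (n - int j) u) (q + int j) w)"
proof -
  have "opposite Y vac u n v = (\<Sum>j\<le>L. (1 / fact j) *\<^sub>C
      (D_operator Y vac ^^ j) ((- 1) powi (n - int j) *\<^sub>C Y v (n - int j) u))"
    unfolding opposite_def by (rule Sum_any_nat) (simp add: L)
  moreover have "((of_int (q + int j) :: complex) gchoose j) = pochhammer (of_int q + 1) j / fact j" for j
    by (simp add: gbinomial_pochhammer')
  ultimately show ?thesis
    by (simp add: clinear_sum[OF YW_linear_left] clinear_scale[OF YW_linear_left] YW_D_power
        mult.commute)
qed

text \<open>Skew symmetry, compared after applying \<open>YW\<close>: there
  \<open>Y t (int j) vac\<close> and \<open>D^j t / j!\<close> both act by the same binomial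
  coefficient.\<close>

lemma YW_opposite_skew:
  assumes "S_jacobi Y v u (map (\<lambda>(v', u'). (v', u', 1)) ts)"
  shows "YW (opposite Y vac u n v) q w = (\<Sum>(u', v')\<leftarrow>ts. YW (Y u' n v') q w)"
proof -
  obtain N where N: "\<forall>n<N. Y v n u = 0"
    using Y_eventually_0 by blast
  define L where "L = nat (n - N)"
  have L: "Y v (n - int j) u = 0" if "j > L" for j
    using that N by (auto simp: L_def)
  have "(\<Sum>(u', v')\<leftarrow>ts. Y u' n v') = (- 1) powi n *\<^sub>C ((- 1) powi n *\<^sub>C (\<Sum>(u', v')\<leftarrow>ts. Y u' n v'))"
    by (simp add: power_int_minus_left)
  also have "\<dots> = (- 1) powi n *\<^sub>C (\<Sum>j\<le>L. (- 1) ^ j *\<^sub>C Y (Y v (n - int j) u) (int j) vac)"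
    unfolding S_jacobi_skew_symmetry[OF assms] by (subst Sum_any_nat[of L]) (simp_all add: L)
  finally have sum: "(\<Sum>(u', v')\<leftarrow>ts. Y u' n v') =
    (- 1) powi n *\<^sub>C (\<Sum>j\<le>L. (- 1) ^ j *\<^sub>C Y (Y v (n - int j) u) (int j) vac)" .
  have "(\<Sum>(u', v')\<leftarrow>ts. YW (Y u' n v') q w) = YW (\<Sum>(u', v')\<leftarrow>ts. Y u' n v') q w"
    by (simp add: case_prod_unfold clinear_sum_list[OF YW_linear_left])
  also have "\<dots> = (\<Sum>j\<le>L. ((- 1) powi (n - int j) * (of_int (q + int j) gchoose j)) *\<^sub>C
      YW (Y v (n - int j) u) (q + int j) w)"
  proof -
    show ?thesis
      unfolding sum
      by (simp add: clinear_sum[OF YW_linear_left] clinear_scale[OF YW_linear_left] YW_creation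
          minus_one_powi_diff cvec.scale_sum_right)
  qed
  finally show ?thesis
    using YW_opposite[OF L] by simp
qed

text \<open>With \<open>P\<close> the regularized product, weak associativity at \<open>- z\<close>,
  translated by \<open>z\<close>, reads
  \<open>Y_W(Y(v,-z) u, x + z) w = (-z)^(-k) P(x, x + z)\<close>. The factor
  \<open>(-z)^(-k)\<close> accounts for both the sign and the shift
  \<open>p - int k\<close>.\<close>

lemma YW_opposite_diag_coeff:
  assumes "assoc_order k v u"
  shows "YW (opposite Y vac u (p - int k) v) q w = (if p < 0 then 0 else
    (- 1) ^ k *\<^sub>C diag_coeff (nat p) (q + p) (regularized_product YW k v u w \<circ> prod.swap))"
proof -
  obtain N where N: "bounded_below N (regularized_product YW k v u w)"
    using assoc_orderD(1)[OF assms] by blast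
  obtain N' where N': "\<forall>n<N'. Y v n u = 0"
    using Y_eventually_0 by blast
  \<comment> \<open>Large enough to truncate the series of the opposite operator and to contain the
    range \<open>{..nat p}\<close> of \<open>diag_coeff_swap\<close>.\<close>
  define L where "L = nat (max p (p - int k - N'))"
  define c where "c j = (- 1) powi (p - int k - int j) * ((of_int (q + int j) :: complex) gchoose j)" for j
  define P where "P = regularized_product YW k v u w"
  have 1: "YW (opposite Y vac u (p - int k) v) q w =
    (\<Sum>j\<le>L. c j *\<^sub>C YW (Y v (p - int k - int j) u) (q + int j) w)"
    unfolding c_def by (rule YW_opposite) (use N' in \<open>auto simp: L_def\<close>)
  have 2: "YW (Y v (p - int k - int j) u) (q + int j) w =
      (if p < int j then 0 else diag_coeff (nat p - j) (q + p) P)" for j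
    using assoc_orderD(2)[OF assms, of "p - int j" "q + int j" w]
    by (simp add: algebra_simps nat_diff_distrib P_def)
  show ?thesis
  proof (cases "p < 0")
    case True
    then show ?thesis unfolding 1 2 by simp
  next
    case False
    have "(\<Sum>j\<le>L. c j *\<^sub>C (if p < int j then 0 else diag_coeff (nat p - j) (q + p) P))
        = (\<Sum>j\<le>nat p. c j *\<^sub>C (if p < int j then 0 else diag_coeff (nat p - j) (q + p) P))"
      using False by (intro sum.mono_neutral_right) (auto simp: L_def)
    also have "\<dots> = (\<Sum>j\<le>nat p. (- 1) ^ k *\<^sub>C ((- 1) ^ (nat p - j) *
        (of_int (q + p - int (nat p) + int j) gchoose j)) *\<^sub>C diag_coeff (nat p - j) (q + p) P)"
    proof (rule sum.cong[OF refl])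
      fix j assume j: "j \<in> {..nat p}"
      have "p - int k - int j = int (nat p - j) - int k"
        using j False by simp
      then have "(- 1) powi (p - int k - int j) = ((- 1) powi (int (nat p - j) - int k) :: complex)"
        by (rule arg_cong)
      also have "\<dots> = (- 1) ^ k * (- 1) ^ (nat p - j)"
        by (simp only: minus_one_powi_diff power_int_of_nat mult.commute)
      finally have "(- 1) powi (p - int k - int j) = ((- 1) ^ k * (- 1) ^ (nat p - j) :: complex)" .
      then show "c j *\<^sub>C (if p < int j then 0 else diag_coeff (nat p - j) (q + p) P) =
        (- 1) ^ k *\<^sub>C ((- 1) ^ (nat p - j) *
        (of_int (q + p - int (nat p) + int j) gchoose j)) *\<^sub>C diag_coeff (nat p - j) (q + p) P"
        using False atMost_iff[THEN iffD1, OF j] by (auto simp: c_def)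
    qed
    also have "\<dots> = (- 1) ^ k *\<^sub>C diag_coeff (nat p) (q + p) (P \<circ> prod.swap)"
      unfolding cvec.scale_sum_right[symmetric] P_def diag_coeff_swap[OF N] ..
    finally show ?thesis
      unfolding 1 2 using False by (simp add: P_def)
  qed
qed

text \<open>After the substitution both sides equal \<open>Y_W\<close> of the opposite product, up
  to the same power of \<open>z\<close>; injectivity of the substitution then identifies the series.
  The sign compares \<open>(x1 - x2)^k\<close> with \<open>(x2 - x1)^k\<close>.\<close>

lemma S_commutativity:
  assumes J: "S_jacobi Y v u (map (\<lambda>(v', u'). (v', u', 1)) ts)"
    and k: "assoc_order k v u" "\<And>u' v'. (u', v') \<in> set ts \<Longrightarrow> assoc_order k u' v'"
  shows "regularized_product YW k v u w (m, n) =
    (- 1) ^ k *\<^sub>C (\<Sum>(u', v')\<leftarrow>ts. regularized_product YW k u' v' w (n, m))"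
proof -
  define P where "P = regularized_product YW k v u w \<circ> prod.swap"
  define R where "R = (\<lambda>x. \<Sum>t\<leftarrow>ts. (case t of (u', v') \<Rightarrow> regularized_product YW k u' v' w) x)"
  have "\<exists>N. bounded_below N (case t of (u', v') \<Rightarrow> regularized_product YW k u' v' w)" if "t \<in> set ts" for t
    using assoc_orderD(1)[OF k(2)] that by (cases t) auto
  from diag_coeff_sum_list[of ts "\<lambda>t. case t of (u', v') \<Rightarrow> regularized_product YW k u' v' w", OF this]
  have R_bdd: "\<exists>N. bounded_below N R"
    and R: "diag_coeff p s R = (\<Sum>t\<leftarrow>ts. diag_coeff p s (case t of (u', v') \<Rightarrow> regularized_product YW k u' v' w))"
    for p s
    unfolding R_def by blast+
  obtain N where "bounded_below N (regularized_product YW k v u w)"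
    using assoc_orderD(1)[OF k(1)] by blast
  then have P_bdd: "bounded_below N P"
    by (auto simp: P_def bounded_below_def)
  obtain N' where R_bdd: "bounded_below N' R"
    using R_bdd by blast
  then have R_bdd': "bounded_below N' (\<lambda>x. (- 1) ^ k *\<^sub>C R x)"
    by (auto simp: bounded_below_def)
  have "diag_coeff p s R = (- 1) ^ k *\<^sub>C diag_coeff p s P" for p s
  proof -
    have "diag_coeff p s R = (\<Sum>(u', v')\<leftarrow>ts. YW (Y u' (int p - int k) v') (s - int p) w)"
      unfolding R
    proof (intro arg_cong[where f = sum_list] map_cong refl)
      fix t assume t: "t \<in> set ts"
      obtain u' v' where "t = (u', v')" by (cases t)
      then show "diag_coeff p s (case t of (u', v') \<Rightarrow> regularized_product YW k u' v' w)
          = (case t of (u', v') \<Rightarrow> YW (Y u' (int p - int k) v') (s - int p) w)"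
        using assoc_orderD(2)[OF k(2), of u' v' "int p" "s - int p" w] t by simp
    qed
    also have "\<dots> = YW (opposite Y vac u (int p - int k) v) (s - int p) w"
      using YW_opposite_skew[OF J] by simp
    also have "\<dots> = (- 1) ^ k *\<^sub>C diag_coeff p s P"
      unfolding YW_opposite_diag_coeff[OF k(1)] by (simp add: P_def)
    finally show ?thesis .
  qed
  moreover have "diag_coeff p s (\<lambda>x. (- 1) ^ k *\<^sub>C R x) = (- 1) ^ k *\<^sub>C diag_coeff p s R" for p s
    using diag_coeff_linear[OF _ R_bdd, of "\<lambda>x. (- 1) ^ k *\<^sub>C x" p s]
    by (simp add: clinear_iff scaleC_add_right cvec.scale_left_commute o_def)
  ultimately have "diag_coeff p s (\<lambda>x. P x - (- 1) ^ k *\<^sub>C R x) = 0" for p s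
    unfolding diag_coeff_diff[OF P_bdd R_bdd'] by (simp flip: power_mult_distrib)
  moreover have "bounded_below (min N N') (\<lambda>x. P x - (- 1) ^ k *\<^sub>C R x)"
    using P_bdd R_bdd' by (auto simp: bounded_below_def)
  ultimately have "P (n, m) - (- 1) ^ k *\<^sub>C R (n, m) = 0"
    by (intro diag_coeff_eq_0_imp[of _ "\<lambda>x. P x - (- 1) ^ k *\<^sub>C R x"])
  then show ?thesis
    by (simp add: P_def R_def case_prod_unfold)
qed

end


section \<open>The dual\<close>

lemma subspace_full_dual: "cvec.subspace full_dual"
  by (auto simp: cvec.subspace_def full_dual_def clinear_iff scaleC_fun_def scaleC_add_right
      cvec.scale_left_commute algebra_simps)

context weak_quantum_vertex_algebra_module
begin

lemma dual_Y_in_full_dual: "\<alpha> \<in> full_dual \<Longrightarrow> dual_Y YW v n \<alpha> \<in> full_dual"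
  by (simp add: full_dual_def dual_Y_def clinear_iff clinear_add[OF YW_linear_right]
      clinear_scale[OF YW_linear_right])

text \<open>Inverting \<open>x\<close> turns truncation from below into a bound from above. The
  bound is uniform in \<open>w\<close> because a functional vanishes only if it does so on every
  vector.\<close>

lemma dual_D_iff:
  "\<alpha> \<in> dual_D YW \<longleftrightarrow> clinear \<alpha> \<and> (\<forall>v. \<exists>M. \<forall>m>M. \<forall>w. \<alpha> (YW v m w) = 0)"
proof -
  have "(\<exists>N. \<forall>n<N. dual_Y YW v n \<alpha> = 0) \<longleftrightarrow> (\<exists>M. \<forall>m>M. \<forall>w. \<alpha> (YW v m w) = 0)" for v
  proof
    assume "\<exists>N. \<forall>n<N. dual_Y YW v n \<alpha> = 0"
    then obtain N where "dual_Y YW v n \<alpha> = 0" if "n < N" for n by blast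
    from this[of "- m" for m] have "\<forall>m>(- N). \<forall>w. \<alpha> (YW v m w) = 0"
      by (simp add: dual_Y_def fun_eq_iff)
    then show "\<exists>M. \<forall>m>M. \<forall>w. \<alpha> (YW v m w) = 0" ..
  next
    assume "\<exists>M. \<forall>m>M. \<forall>w. \<alpha> (YW v m w) = 0"
    then obtain M where "\<forall>m>M. \<forall>w. \<alpha> (YW v m w) = 0" ..
    then have "\<forall>n<(- M). dual_Y YW v n \<alpha> = 0"
      by (simp add: dual_Y_def fun_eq_iff)
    then show "\<exists>N. \<forall>n<N. dual_Y YW v n \<alpha> = 0" ..
  qed
  then show ?thesis
    using dual_Y_in_full_dual by (auto simp: dual_D_def laurent_on_def full_dual_def)
qed

lemma subspace_dual_D: "cvec.subspace (dual_D YW)"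
proof (rule cvec.subspaceI)
  show "0 \<in> dual_D YW"
    using cvec.subspace_0[OF subspace_full_dual] by (simp add: dual_D_iff full_dual_def)
next
  fix \<alpha> \<beta> assume "\<alpha> \<in> dual_D YW" "\<beta> \<in> dual_D YW"
  then have lin: "clinear \<alpha>" "clinear \<beta>"
    and bdd: "\<And>v. \<exists>M. \<forall>m>M. \<forall>w. \<alpha> (YW v m w) = 0" "\<And>v. \<exists>M. \<forall>m>M. \<forall>w. \<beta> (YW v m w) = 0"
    unfolding dual_D_iff by blast+
  have "\<exists>M. \<forall>m>M. \<forall>w. (\<alpha> + \<beta>) (YW v m w) = 0" for v
  proof -
    obtain M M' where "\<forall>m>M. \<forall>w. \<alpha> (YW v m w) = 0" "\<forall>m>M'. \<forall>w. \<beta> (YW v m w) = 0"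
      using bdd by meson
    then have "\<forall>m>max M M'. \<forall>w. (\<alpha> + \<beta>) (YW v m w) = 0" by simp
    then show ?thesis ..
  qed
  moreover have "clinear (\<alpha> + \<beta>)"
    using cvec.subspace_add[OF subspace_full_dual] lin by (simp add: full_dual_def)
  ultimately show "\<alpha> + \<beta> \<in> dual_D YW"
    unfolding dual_D_iff by blast
next
  fix c \<alpha> assume \<alpha>: "\<alpha> \<in> dual_D YW"
  then have "clinear (c *\<^sub>C \<alpha>)"
    using cvec.subspace_scale[OF subspace_full_dual, of \<alpha> c] by (simp add: dual_D_iff full_dual_def)
  moreover have "(c *\<^sub>C \<alpha>) x = 0" if "\<alpha> x = 0" for x
    using that by (simp add: scaleC_fun_def)
  ultimately show "c *\<^sub>C \<alpha> \<in> dual_D YW"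
    using \<alpha> unfolding dual_D_iff by meson
qed

end

locale constant_weak_quantum_vertex_algebra_module =
  constant_weak_quantum_vertex_algebra Y vac + weak_quantum_vertex_algebra_module Y vac YW
  for Y :: "'v::complex_vector \<Rightarrow> int \<Rightarrow> 'v \<Rightarrow> 'v" and vac
    and YW :: "'v \<Rightarrow> int \<Rightarrow> 'w::complex_vector \<Rightarrow> 'w"
begin

section \<open>Uniform bounds and stability of the dual\<close>

lemma S_commutativity_exists:
  "\<exists>k ts. assoc_order k v u \<and> (\<forall>w m n. regularized_product YW k v u w (m, n) =
      (- 1) ^ k *\<^sub>C (\<Sum>(u', v')\<leftarrow>ts. regularized_product YW k u' v' w (n, m)))"
proof -
  obtain ts where ts: "S_jacobi Y v u (map (\<lambda>(v', u'). (v', u', 1)) ts)"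
    using constant_S by blast
  obtain k where k: "\<forall>(a, b)\<in>insert (v, u) (set ts). assoc_order k a b"
    using assoc_order_uniform[of "insert (v, u) (set ts)"] by auto
  then have "assoc_order k v u" and "\<And>u' v'. (u', v') \<in> set ts \<Longrightarrow> assoc_order k u' v'"
    by auto
  then show ?thesis
    using S_commutativity[OF ts] by blast
qed

text \<open>The \<open>k\<close> of weak associativity, with bounds that do not depend on \<open>w\<close>: the power of
  \<open>x\<^sub>1\<close> is bounded above because \<open>Y\<^sub>W(v,x\<^sub>1)\<close> stands next to \<open>\<alpha>\<close>, that of \<open>x\<^sub>2\<close> because
  \<open>\<S>\<close>-commutativity moves operators in \<open>x\<^sub>2\<close> there.\<close>

lemma regularized_product_bounded_above:
  "\<exists>k. assoc_order k v u \<and> (\<forall>\<alpha>\<in>dual_D YW. \<exists>M. \<forall>m n w. m > M \<or> n > M \<longrightarrow>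
    \<alpha> (regularized_product YW k v u w (m, n)) = 0)"
proof -
  obtain k ts where k: "assoc_order k v u"
    and comm: "\<And>w m n. regularized_product YW k v u w (m, n) =
      (- 1) ^ k *\<^sub>C (\<Sum>(u', v')\<leftarrow>ts. regularized_product YW k u' v' w (n, m))"
    using S_commutativity_exists[of v u] by blast
  have "\<exists>M. \<forall>m n w. m > M \<or> n > M \<longrightarrow> \<alpha> (regularized_product YW k v u w (m, n)) = 0"
    if \<alpha>: "\<alpha> \<in> dual_D YW" for \<alpha>
  proof -
    have lin: "clinear \<alpha>"
      using \<alpha> by (simp add: dual_D_iff)
    have fst: "\<exists>M. \<forall>m>M. \<forall>n w. \<alpha> (regularized_product YW k a b w (m, n)) = 0" for a b
    proof -
      obtain M where M: "\<forall>m>M. \<forall>w. \<alpha> (YW a m w) = 0"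
        using \<alpha> unfolding dual_D_iff by blast
      have "\<alpha> (regularized_product YW k a b w (m, n)) = 0" if "m > M + int k" for m n w
        unfolding regularized_product_eq mult_diff_power_linear[OF lin]
        by (rule mult_diff_power_eq_0_fst[OF _ that]) (simp add: M)
      then show ?thesis by blast
    qed
    have snd: "\<exists>M. \<forall>n>M. \<forall>m w. \<alpha> (\<Sum>(u', v')\<leftarrow>ts. regularized_product YW k u' v' w (n, m)) = 0"
    proof (induction ts)
      case Nil
      show ?case by (simp add: clinear_0[OF lin])
    next
      case (Cons t ts)
      then obtain M where M: "\<forall>n>M. \<forall>m w. \<alpha> (\<Sum>(u', v')\<leftarrow>ts. regularized_product YW k u' v' w (n, m)) = 0"
        by blast
      obtain a b where t: "t = (a, b)" by (cases t)
      obtain M' where "\<forall>m>M'. \<forall>n w. \<alpha> (regularized_product YW k a b w (m, n)) = 0"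
        using fst by blast
      with M have "\<forall>n>max M M'. \<forall>m w.
          \<alpha> (\<Sum>(u', v')\<leftarrow>t # ts. regularized_product YW k u' v' w (n, m)) = 0"
        by (simp add: t clinear_add[OF lin])
      then show ?case ..
    qed
    obtain M1 where M1: "\<forall>m>M1. \<forall>n w. \<alpha> (regularized_product YW k v u w (m, n)) = 0"
      using fst by blast
    obtain M2 where M2: "\<forall>n>M2. \<forall>m w.
        \<alpha> (\<Sum>(u', v')\<leftarrow>ts. regularized_product YW k u' v' w (n, m)) = 0"
      using snd by blast
    have "\<alpha> (regularized_product YW k v u w (m, n)) = 0" if "n > M2" for m n w
      unfolding comm clinear_scale[OF lin] using M2 that by simp
    with M1 have "\<forall>m n w. m > max M1 M2 \<or> n > max M1 M2 \<longrightarrow>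
        \<alpha> (regularized_product YW k v u w (m, n)) = 0"
      by auto
    then show ?thesis ..
  qed
  with k show ?thesis by blast
qed

lemma dual_D_closed:
  assumes \<alpha>: "\<alpha> \<in> dual_D YW"
  shows "dual_Y YW v n \<alpha> \<in> dual_D YW"
proof -
  have lin: "clinear \<alpha>"
    using \<alpha> by (simp add: dual_D_iff)
  have "\<exists>M. \<forall>m>M. \<forall>w. dual_Y YW v n \<alpha> (YW u m w) = 0" for u
  proof -
    obtain k where "\<And>\<alpha>. \<alpha> \<in> dual_D YW \<Longrightarrow>
        \<exists>M. \<forall>m n w. m > M \<or> n > M \<longrightarrow> \<alpha> (regularized_product YW k v u w (m, n)) = 0"
      using regularized_product_bounded_above[of v u] by blast
    then obtain M where M: "\<And>m n w. m > M \<or> n > M \<Longrightarrow> \<alpha> (regularized_product YW k v u w (m, n)) = 0"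
      using \<alpha> by blast
    obtain M' where M': "\<forall>m>M'. \<forall>w. \<alpha> (YW v m w) = 0"
      using \<alpha> unfolding dual_D_iff by blast
    \<comment> \<open>The total degree of the regularized product under \<alpha> is at most
      \<open>2 * M\<close>, and dividing out \<open>(x1 - x2)^k\<close> does not raise it. Fixing
      the first exponent at \<open>- n\<close> therefore bounds the second by
      \<open>2 * M + n\<close>, for all \<open>w\<close> at once.\<close>
    have "\<alpha> (YW v (- n) (YW u m w)) = 0" if "m > 2 * M + n" for m w
    proof -
      define F where "F = \<alpha> \<circ> (\<lambda>(m, n). YW v m (YW u n w))"
      have "F (- n, m) = 0"
      proof (rule mult_diff_power_cancel_total_degree[of M' F "2 * M" k])
        show "F (m, n) = 0" if "m > M'" for m n
          using M' that by (simp add: F_def)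
        show "(mult_diff ^^ k) F (i, j) = 0" if "i + j > 2 * M + int k" for i j
          using M[of i j w] that
          unfolding F_def mult_diff_power_linear[OF lin, symmetric] regularized_product_eq
          by linarith
      qed (use that in simp)
      then show ?thesis by (simp add: F_def)
    qed
    then show ?thesis
      unfolding dual_Y_def by blast
  qed
  then show ?thesis
    using dual_Y_in_full_dual[of \<alpha> v n] lin by (simp add: dual_D_iff full_dual_def)
qed

section \<open>The module axioms on the dual\<close>

lemma laurent_on_dual_Y:
  assumes "\<alpha> \<in> dual_D YW"
  shows "laurent_on (dual_D YW) (\<lambda>n. dual_Y YW v n \<alpha>)"
  using assms dual_D_closed by (auto simp: dual_D_def laurent_on_def)

text \<open>Dualizing reverses the order of the operators and inverts both variables, exactly the
  reflection of \<open>mult_diff_power_reflect\<close>.\<close>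

lemma regularized_product_dual_Y:
  assumes "\<alpha> \<in> dual_D YW"
  shows "regularized_product (dual_Y YW) k u v \<alpha> (m, n) w =
    \<alpha> (regularized_product YW k v u w (int k - n, int k - m))"
proof -
  have lin: "clinear \<alpha>"
    using assms by (simp add: dual_D_iff)
  define F where "F = \<alpha> \<circ> (\<lambda>(m, n). YW v m (YW u n w))"
  have "regularized_product (dual_Y YW) k u v \<alpha> (m, n) w
      = (mult_diff ^^ k) ((\<lambda>f. f w) \<circ> (\<lambda>(m, n). dual_Y YW u m (dual_Y YW v n \<alpha>))) (m, n)"
    unfolding regularized_product_eq by (rule mult_diff_power_linear[OF eval_clinear])
  also have "(\<lambda>f. f w) \<circ> (\<lambda>(m, n). dual_Y YW u m (dual_Y YW v n \<alpha>)) = (\<lambda>(m, n). F (- n, - m))"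
    by (auto simp: F_def dual_Y_def)
  also have "(mult_diff ^^ k) \<dots> (m, n) = (mult_diff ^^ k) F (int k - n, int k - m)"
    by (rule mult_diff_power_reflect)
  finally show ?thesis
    by (simp add: F_def regularized_product_eq mult_diff_power_linear[OF lin])
qed

lemma laurent2_on_dual_Y:
  assumes \<alpha>: "\<alpha> \<in> dual_D YW"
    and M: "\<And>m n w. m > M \<or> n > M \<Longrightarrow> \<alpha> (regularized_product YW k v u w (m, n)) = 0"
  shows "bounded_below (int k - M) (regularized_product (dual_Y YW) k u v \<alpha>)"
    and "laurent2_on (dual_D YW) (regularized_product (dual_Y YW) k u v \<alpha>)"
proof -
  show "bounded_below (int k - M) (regularized_product (dual_Y YW) k u v \<alpha>)"
    by (auto simp: bounded_below_def regularized_product_dual_Y[OF \<alpha>] fun_eq_iff intro!: M)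
  moreover have "regularized_product (dual_Y YW) k u v \<alpha> x \<in> dual_D YW" for x
    unfolding regularized_product_eq
    by (rule mult_diff_power_in_subspace[OF subspace_dual_D]) (auto intro: dual_D_closed \<alpha>)
  ultimately show "laurent2_on (dual_D YW) (regularized_product (dual_Y YW) k u v \<alpha>)"
    unfolding laurent2_on_def bounded_below_def by blast
qed

lemma opposite_eventually_0: "\<exists>N. \<forall>n<N. opposite Y vac u n v = 0"
proof -
  obtain N where N: "\<forall>n<N. Y v n u = 0"
    using Y_eventually_0 by blast
  then have "opposite Y vac u n v = 0" if "n < N" for n
    using that by (simp add: opposite_def)
  then show ?thesis by blast
qed

text \<open>Evaluated at \<open>w\<close>, both sides are read off from one Laurent polynomial
  \<open>F\<close>. The left side has weights \<open>m - k\<close>; the right side is a convolution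
  with the binomials of \<open>(1 + z x)^(-k)\<close>, and \<open>diag_coeff_translate\<close> with
  \<open>c = - k\<close> identifies them.\<close>

lemma dual_weak_associativity:
  assumes \<alpha>: "\<alpha> \<in> dual_D YW" and k: "assoc_order k v u"
    and M: "\<And>m n w. m > M \<or> n > M \<Longrightarrow> \<alpha> (regularized_product YW k v u w (m, n)) = 0"
  shows "subst_phi phi_inv (regularized_product (dual_Y YW) k u v \<alpha>) =
    series_mult (zx_coeff ((phi_inv - fps_const fls_X) ^ k))
      (\<lambda>(p, q). dual_Y YW (opposite Y vac u p v) q \<alpha>)" (is "?L = ?R")
proof (intro ext)
  fix pq :: "int \<times> int" and w
  obtain p q where pq: "pq = (p, q)" by (cases pq)
  \<comment> \<open>The exponents \<open>m\<close> and \<open>q - p - m\<close> on the dual side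
    reflect to \<open>k - m\<close> and \<open>k - (q - p - m)\<close>, whose sum is
    \<open>T\<close>.\<close>
  define T where "T = 2 * int k - q + p"
  have lin: "clinear \<alpha>"
    using \<alpha> by (simp add: dual_D_iff)
  define F where "F = \<alpha> \<circ> (regularized_product YW k v u w \<circ> prod.swap)"
  obtain N where "bounded_below N (regularized_product YW k v u w)"
    using assoc_orderD(1)[OF k] by blast
  then have N: "bounded_below N (regularized_product YW k v u w \<circ> prod.swap)"
    by (auto simp: bounded_below_def)
  then have F: "bounded_below N F"
    by (auto simp: bounded_below_def F_def clinear_0[OF lin])

  have "?L pq w = (if p < 0 then 0 else
    (\<Sum>m\<in>{N..T - N}. ((of_int m - of_nat k) gchoose nat p) *\<^sub>C F (m, T - m)))"
  proof -
    let ?G = "regularized_product (dual_Y YW) k u v \<alpha>"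
    define g where "g m = (- of_int m gchoose nat p) *\<^sub>C ?G (m, q - p - m)" for m
    \<comment> \<open>Evaluation at \<open>w\<close> is exchanged with the sum of functionals, which
      relies on finite support there and hence on a bound \<open>M\<close> uniform in
      \<open>w\<close>.\<close>
    have "finite {m. g m \<noteq> 0}"
    proof (rule finite_subset)
      show "{m. g m \<noteq> 0} \<subseteq> {int k - M..q - p - (int k - M)}"
        using laurent2_on_dual_Y(1)[OF \<alpha> M] by (force simp: g_def bounded_below_def)
    qed simp
    then have "Sum_any g w = Sum_any (\<lambda>m. g m w)"
      by (rule clinear_Sum_any[OF eval_clinear])
    also have "\<dots> = Sum_any (\<lambda>m. ((of_int m - of_nat k) gchoose nat p) *\<^sub>C F (m, T - m))"
    proof (rule Sum_any.reindex_cong)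
      show "bij (\<lambda>m. int k - m)"
        by (rule bij_betw_byWitness[of _ "\<lambda>m. int k - m"]) auto
      show "(\<lambda>m. g m w) \<circ> (\<lambda>m. int k - m) =
          (\<lambda>m. ((of_int m - of_nat k) gchoose nat p) *\<^sub>C F (m, T - m))"
        by (auto simp: g_def F_def T_def scaleC_fun_def regularized_product_dual_Y[OF \<alpha>] algebra_simps)
    qed
    also have "\<dots> = (\<Sum>m\<in>{N..T - N}. ((of_int m - of_nat k) gchoose nat p) *\<^sub>C F (m, T - m))"
    proof (rule Sum_any.expand_superset)
      show "{m. ((of_int m - of_nat k) gchoose nat p) *\<^sub>C F (m, T - m) \<noteq> 0} \<subseteq> {N..T - N}"
        using F by (force simp: bounded_below_def)
    qed simp
    finally show ?thesis
      by (simp add: pq subst_phi_inv g_def)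
  qed
  moreover have "?R pq w = (if p < 0 then 0 else
    (\<Sum>i\<le>nat p. (- of_nat k gchoose i) *\<^sub>C diag_coeff (nat p - i) T F))"
  proof -
    define c where "c = zx_coeff ((phi_inv - fps_const fls_X) ^ k)"
    define H where "H p q = dual_Y YW (opposite Y vac u p v) q \<alpha>" for p q
    define h where "h i = (int k + int i, 2 * int k + int i)" for i :: nat
    define g where "g x = c x *\<^sub>C (case pq - x of (p, q) \<Rightarrow> H p q)" for x
    obtain N' where N': "\<forall>n<N'. opposite Y vac u n v = 0"
      using opposite_eventually_0 by blast
    define L where "L = nat (max p (p - int k - N'))"
    have gh: "g (h i) = ((- 1) ^ k * (- of_nat k gchoose i)) *\<^sub>C H (p - int i - int k) (q - 2 * int k - int i)" for i
      by (simp add: g_def h_def c_def zx_coeff_phi_inv_diff_power pq algebra_simps)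
    have "?R pq = Sum_any g"
      by (simp add: series_mult_def g_def c_def H_def)
    also have "\<dots> = Sum_any (\<lambda>i. g (h i))"
    proof (rule Sum_any_inj)
      show "inj h" by (rule injI) (simp add: h_def)
      fix x assume x: "x \<notin> range h"
      obtain a b where ab: "x = (a, b)" by (cases x)
      have "\<not> (a \<ge> int k \<and> b = a + int k)"
      proof
        assume "a \<ge> int k \<and> b = a + int k"
        then have "x = h (nat (a - int k))" by (simp add: h_def ab)
        then show False using x by blast
      qed
      then show "g x = 0"
        by (auto simp: g_def ab c_def zx_coeff_phi_inv_diff_power)
    qed
    also have "\<dots> = (\<Sum>i\<le>L. g (h i))"
    proof (rule Sum_any_nat)
      fix i assume "i > L"
      then have "opposite Y vac u (p - int i - int k) v = 0"
        using N' by (auto simp: L_def)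
      then show "g (h i) = 0"
        by (simp add: gh H_def dual_Y_def clinear_0[OF lin] zero_fun_def[symmetric])
    qed
    finally have "?R pq w = (\<Sum>i\<le>L. g (h i) w)"
      by (simp add: sum_apply)
    also have "\<dots> = (\<Sum>i\<le>L. if p < int i then 0 else
        (- of_nat k gchoose i) *\<^sub>C diag_coeff (nat p - i) T F)"
    proof (rule sum.cong[OF refl])
      fix i
      \<comment> \<open>The total degree \<open>- (q - 2 k - i) + (p - i)\<close> is
        \<open>T\<close> for every \<open>i\<close>, so all summands lie in the same degree; the
        sign \<open>(-1)^k\<close> cancels the one in \<open>gh\<close>.\<close>
      have "H (p - int i - int k) (q - 2 * int k - int i) w = (if p < int i then 0 else
          (- 1) ^ k *\<^sub>C diag_coeff (nat p - i) T F)"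
        using YW_opposite_diag_coeff[OF k, of "p - int i" "- (q - 2 * int k - int i)" w]
        by (simp add: H_def dual_Y_def clinear_0[OF lin] clinear_scale[OF lin] F_def T_def
            nat_diff_distrib algebra_simps flip: diag_coeff_linear[OF lin N])
      then show "g (h i) w = (if p < int i then 0 else
        (- of_nat k gchoose i) *\<^sub>C diag_coeff (nat p - i) T F)"
        by (simp add: gh scaleC_fun_def flip: power_mult_distrib)
    qed
    also have "\<dots> = (if p < 0 then 0 else
      (\<Sum>i\<le>nat p. (- of_nat k gchoose i) *\<^sub>C diag_coeff (nat p - i) T F))"
    proof (cases "p < 0")
      case False
      have "(\<Sum>i\<le>L. if p < int i then 0 else (- of_nat k gchoose i) *\<^sub>C diag_coeff (nat p - i) T F)
          = (\<Sum>i\<le>nat p. if p < int i then 0 else (- of_nat k gchoose i) *\<^sub>C diag_coeff (nat p - i) T F)"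
        using False by (intro sum.mono_neutral_right) (auto simp: L_def)
      also have "\<dots> = (\<Sum>i\<le>nat p. (- of_nat k gchoose i) *\<^sub>C diag_coeff (nat p - i) T F)"
        using False by (intro sum.cong) auto
      finally show ?thesis using False by simp
    qed simp
    finally show ?thesis .
  qed
  ultimately show "?L pq w = ?R pq w"
    by (simp add: diag_coeff_translate[OF F])
qed

lemma phi_coordinated_module_dual:
  "phi_coordinated_module phi_inv (opposite Y vac) vac (dual_D YW) (dual_Y YW)"
proof (rule phi_coordinated_module.intro)
  fix \<alpha> \<beta> v n c
  show "cvec.subspace (dual_D YW)" by (rule subspace_dual_D)
  assume \<alpha>: "\<alpha> \<in> dual_D YW"
  have lin: "clinear \<alpha>"
    using \<alpha> by (simp add: dual_D_iff)
  show "dual_Y YW v n \<alpha> \<in> dual_D YW" using \<alpha> by (rule dual_D_closed)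
  show "clinear (\<lambda>v. dual_Y YW v n \<alpha>)"
    by (simp add: clinear_iff dual_Y_def fun_eq_iff scaleC_fun_def clinear_add[OF YW_linear_left]
        clinear_scale[OF YW_linear_left] clinear_add[OF lin] clinear_scale[OF lin])
  show "dual_Y YW v n (\<alpha> + \<beta>) = dual_Y YW v n \<alpha> + dual_Y YW v n \<beta>"
    by (simp add: dual_Y_def fun_eq_iff)
  show "dual_Y YW v n (c *\<^sub>C \<alpha>) = c *\<^sub>C dual_Y YW v n \<alpha>"
    by (simp add: dual_Y_def fun_eq_iff scaleC_fun_def)
  show "laurent_on (dual_D YW) (\<lambda>n. dual_Y YW v n \<alpha>)"
    using \<alpha> by (rule laurent_on_dual_Y)
  show "dual_Y YW vac n \<alpha> = (if n = 0 then \<alpha> else 0)"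
    by (auto simp: dual_Y_def fun_eq_iff YW_vacuum clinear_0[OF lin])
next
  fix u v
  obtain k where k: "assoc_order k v u"
    and M: "\<And>\<alpha>. \<alpha> \<in> dual_D YW \<Longrightarrow>
      \<exists>M. \<forall>m n w. m > M \<or> n > M \<longrightarrow> \<alpha> (regularized_product YW k v u w (m, n)) = 0"
    using regularized_product_bounded_above[of v u] by blast
  show "\<exists>k. \<forall>\<alpha>\<in>dual_D YW. laurent2_on (dual_D YW) (regularized_product (dual_Y YW) k u v \<alpha>) \<and>
    subst_phi phi_inv (regularized_product (dual_Y YW) k u v \<alpha>) =
    series_mult (zx_coeff ((phi_inv - fps_const fls_X) ^ k))
      (\<lambda>(p, q). dual_Y YW (opposite Y vac u p v) q \<alpha>)"
  \<comment> \<open>\<open>k\<close> is fixed by \<open>u\<close> and \<open>v\<close> before the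
    functional is chosen; only \<open>M\<close> depends on \<alpha>.\<close>
  proof (intro exI[of _ k] ballI)
    fix \<alpha> assume \<alpha>: "\<alpha> \<in> dual_D YW"
    obtain M where "\<And>m n w. m > M \<or> n > M \<Longrightarrow> \<alpha> (regularized_product YW k v u w (m, n)) = 0"
      using M[OF \<alpha>] by blast
    then show "laurent2_on (dual_D YW) (regularized_product (dual_Y YW) k u v \<alpha>) \<and>
      subst_phi phi_inv (regularized_product (dual_Y YW) k u v \<alpha>) =
      series_mult (zx_coeff ((phi_inv - fps_const fls_X) ^ k))
        (\<lambda>(p, q). dual_Y YW (opposite Y vac u p v) q \<alpha>)"
      using laurent2_on_dual_Y(2)[OF \<alpha>] dual_weak_associativity[OF \<alpha> k] by blast
  qed
qed

end

theorem theorem3p5: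
  fixes Y :: "'v::complex_vector \<Rightarrow> int \<Rightarrow> 'v \<Rightarrow> 'v" and vac :: 'v
    and YW :: "'v \<Rightarrow> int \<Rightarrow> 'w::complex_vector \<Rightarrow> 'w"
  assumes "constant_weak_quantum_vertex_algebra Y vac"
    and "va_module Y vac UNIV YW"
  shows "(\<forall>v. \<forall>\<alpha>\<in>dual_D YW. laurent_on (dual_D YW) (\<lambda>n. dual_Y YW v n \<alpha>)) \<and>
    phi_coordinated_module phi_inv (opposite Y vac) vac (dual_D YW) (dual_Y YW)"
proof -
  have "weak_quantum_vertex_algebra Y vac"
    using assms(1) by (rule constant_weak_quantum_vertex_algebra.axioms)
  with assms interpret constant_weak_quantum_vertex_algebra_module Y vac YW
    by (intro constant_weak_quantum_vertex_algebra_module.intro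
        weak_quantum_vertex_algebra_module.intro weak_quantum_vertex_algebra_module_axioms.intro)
  show ?thesis
    by (intro conjI allI ballI laurent_on_dual_Y phi_coordinated_module_dual)
qed

end
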